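(* There are absolute constants $C_0,C_1>0$ such that the following holds. Let $(X,\Pi)$ be a two-sided $\gamma$-local-spectral expander with $\gamma\le2^{-C_0k}$, and let $f\in C_k$ have HD-level-set decomposition $f=f_0+\cdots+f_k$ with $f_j\in V_k^j$. Then for every $\ell\le k$, \[\mathrm{Var}(D^k_\ell f)\in\sum_{j=1}^{\ell}\frac{\binom{\ell}{j}}{\binom{k}{j}}\langle f,f_j\rangle\pm c\gamma\langle f,f\rangle\] for some $c\le 2^{C_1k}$.
   Context: Weighted pure simplicial complex $(X,\Pi)$ of dimension $d$: $X(d)\subseteq\binom{[n]}{d}$, $X(i)$ the $i$-subsets of members of $X(d)$, $\Pi_d=\Pi$ a distribution on $X(d)$, $\Pi_i(x)=\frac1{i+1}\sum_{y\in X(i+1),y\supset x}\Pi_{i+1}(y)$. Link of $s\in X(i)$: $X_s=\{t\setminus s:t\in X,t\supseteq s\}$ with induced distribution. Two-sided $\gamma$-local-spectral expander: for all $0\le i\le d-2$, $s\in X(i)$, the weighted graph on the $1$-faces of $X_s$ with edges the $2$-faces of $X_s$ has all nontrivial random-walk eigenvalues of absolute value $\le\gamma$. $C_k$: functions $X(k)\to\mathbb R$ with $\langle f,g\rangle=\mathbb E_{\Pi_k}[fg]$. $U_kf(y)=\frac1{k+1}\sum_{x\subset y}f(x)$; $D_{k+1}f(x)=\frac1{k+1}\sum_{y\supset x}\frac{\Pi_{k+1}(y)}{\Pi_k(x)}f(y)$; $U^k_\ell=U_{k-1}\cdots U_\ell$, $D^k_\ell=D_{\ell+1}\cdots D_k$.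 $H^0=C_0$, $H^\ell=\mathrm{Ker}(D_\ell)$ for $\ell\ge1$, $V_k^\ell=U^k_\ell H^\ell$; every $f\in C_k$ decomposes uniquely as $f=\sum_\ell f_\ell$ with $f_\ell\in V_k^\ell$ (the HD-level-set decomposition). $\mathrm{Var}(g)$ for $g\in C_\ell$ is the variance under $\Pi_\ell$. *)

theory Defs
  imports Complex_Main
begin

text \<open>
  Dimension is counted as in the source: an \<open>i\<close>-face has exactly \<open>i\<close> elements. A pure complex is
  given by its facets \<open>X(d)\<close>, \<open>d = cdim K\<close>; \<open>facet_wt K\<close> is only meaningful on \<open>facets K\<close>.
\<close>

record wcomplex =
  cdim :: nat
  facets :: "nat set set"
  facet_wt :: "nat set \<Rightarrow> real"

text \<open>
  Positivity of \<open>\<Pi>\<close> on \<open>X(d)\<close> makes every \<open>\<Pi>\<^sub>i\<close> positive on \<open>X(i)\<close>, as needed for the links and for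
  the quotients \<open>\<Pi>\<^sub>k\<^sub>+\<^sub>1(y) / \<Pi>\<^sub>k(x)\<close> in the down operators.
\<close>

definition weighted_complex :: "nat \<Rightarrow> wcomplex \<Rightarrow> bool" where
  "weighted_complex n K \<longleftrightarrow>
     (\<forall>t\<in>facets K. t \<subseteq> {1..n} \<and> card t = cdim K) \<and>
     (\<forall>t\<in>facets K. facet_wt K t > 0) \<and> (\<Sum>t\<in>facets K. facet_wt K t) = 1"

definition faces :: "wcomplex \<Rightarrow> nat \<Rightarrow> nat set set" where
  "faces K i = {x. card x = i \<and> (\<exists>t\<in>facets K. x \<subseteq> t)}"

function face_prob :: "wcomplex \<Rightarrow> nat \<Rightarrow> nat set \<Rightarrow> real" where
  "face_prob K i x =
     (if i \<ge> cdim K then facet_wt K x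
      else 1 / real (i + 1) * (\<Sum>y\<in>{y \<in> faces K (i + 1). x \<subset> y}. face_prob K (i + 1) y))"
  by auto
termination
  by (relation "Wellfounded.measure (\<lambda>(K, i, x). cdim K - i)") auto

declare face_prob.simps [simp del]

text \<open>The induced distribution is that of \<open>t - s\<close> for \<open>t\<close> drawn from \<open>\<Pi>\<close> conditioned on \<open>s \<subseteq> t\<close>.\<close>

definition face_link :: "wcomplex \<Rightarrow> nat set \<Rightarrow> wcomplex" where
  "face_link K s =
     \<lparr> cdim = cdim K - card s,
       facets = (\<lambda>t. t - s) ` {t \<in> facets K. s \<subseteq> t},
       facet_wt = (\<lambda>t. facet_wt K (s \<union> t) / (\<Sum>t'\<in>{t' \<in> facets K. s \<subseteq> t'}. facet_wt K t')) \<rparr>"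

definition skeleton_vertices :: "wcomplex \<Rightarrow> nat set" where
  "skeleton_vertices K = {v. {v} \<in> faces K 1}"

definition skeleton_walk :: "wcomplex \<Rightarrow> (nat \<Rightarrow> real) \<Rightarrow> nat \<Rightarrow> real" where
  "skeleton_walk K g u =
     (\<Sum>v\<in>{v. {u, v} \<in> faces K 2}. face_prob K 2 {u, v} * g v) /
     (\<Sum>v\<in>{v. {u, v} \<in> faces K 2}. face_prob K 2 {u, v})"

text \<open>
  The trivial eigenvalue is the one copy of \<open>1\<close> belonging to the constant functions. An eigenvalue
  is thus nontrivial if it has an eigenfunction that is not constant; in particular \<open>1\<close> itself is
  nontrivial when it has multiplicity at least two. The walk is reversible, so its spectrum is real.
\<close>

definition nontrivial_walk_eigenvalue :: "wcomplex \<Rightarrow> real \<Rightarrow> bool" where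
  "nontrivial_walk_eigenvalue K \<mu> \<longleftrightarrow>
     (\<exists>g. (\<forall>u\<in>skeleton_vertices K. skeleton_walk K g u = \<mu> * g u) \<and>
          (\<exists>u\<in>skeleton_vertices K. \<exists>v\<in>skeleton_vertices K. g u \<noteq> g v))"

definition two_sided_local_spectral_expander :: "wcomplex \<Rightarrow> real \<Rightarrow> bool" where
  "two_sided_local_spectral_expander K \<gamma> \<longleftrightarrow>
     (\<forall>i s. i + 2 \<le> cdim K \<longrightarrow> s \<in> faces K i \<longrightarrow>
        (\<forall>\<mu>. nontrivial_walk_eigenvalue (face_link K s) \<mu> \<longrightarrow> \<bar>\<mu>\<bar> \<le> \<gamma>))"

text \<open>
  Functions \<open>X(k) \<rightarrow> \<real>\<close> are represented by their extension by zero, so that equality in \<open>C\<^sub>k\<close> is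
  equality of HOL functions; accordingly \<open>Up\<close> and \<open>Down\<close> return functions vanishing off their level.
\<close>

definition cochains :: "wcomplex \<Rightarrow> nat \<Rightarrow> (nat set \<Rightarrow> real) set" where
  "cochains K k = {f. \<forall>x. x \<notin> faces K k \<longrightarrow> f x = 0}"

definition face_expect :: "wcomplex \<Rightarrow> nat \<Rightarrow> (nat set \<Rightarrow> real) \<Rightarrow> real" where
  "face_expect K k f = (\<Sum>x\<in>faces K k. face_prob K k x * f x)"

definition face_ip :: "wcomplex \<Rightarrow> nat \<Rightarrow> (nat set \<Rightarrow> real) \<Rightarrow> (nat set \<Rightarrow> real) \<Rightarrow> real" where
  "face_ip K k f g = face_expect K k (\<lambda>x. f x * g x)"

definition face_var :: "wcomplex \<Rightarrow> nat \<Rightarrow> (nat set \<Rightarrow> real) \<Rightarrow> real" where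
  "face_var K k g = face_expect K k (\<lambda>x. (g x - face_expect K k g)\<^sup>2)"

definition Up :: "wcomplex \<Rightarrow> nat \<Rightarrow> (nat set \<Rightarrow> real) \<Rightarrow> nat set \<Rightarrow> real" where
  "Up K k f y =
     (if y \<in> faces K (k + 1)
      then 1 / real (k + 1) * (\<Sum>x\<in>{x \<in> faces K k. x \<subset> y}. f x)
      else 0)"

text \<open>\<open>Down K k\<close> is \<open>D\<^sub>k : C\<^sub>k \<rightarrow> C\<^sub>k\<^sub>-\<^sub>1\<close>, meaningful for \<open>k \<ge> 1\<close>.\<close>

definition Down :: "wcomplex \<Rightarrow> nat \<Rightarrow> (nat set \<Rightarrow> real) \<Rightarrow> nat set \<Rightarrow> real" where
  "Down K k f x =
     (if x \<in> faces K (k - 1)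
      then 1 / real k * (\<Sum>y\<in>{y \<in> faces K k. x \<subset> y}. face_prob K k y / face_prob K (k - 1) x * f y)
      else 0)"

text \<open>
  \<open>Up_iter K l k f = Up K (k - 1) (\<dots> (Up K l f))\<close> and
  \<open>Down_iter K k l f = Down K (l + 1) (\<dots> (Down K k f))\<close>.
\<close>

definition Up_iter :: "wcomplex \<Rightarrow> nat \<Rightarrow> nat \<Rightarrow> (nat set \<Rightarrow> real) \<Rightarrow> nat set \<Rightarrow> real" where
  "Up_iter K l k f = fold (Up K) [l..<k] f"

definition Down_iter :: "wcomplex \<Rightarrow> nat \<Rightarrow> nat \<Rightarrow> (nat set \<Rightarrow> real) \<Rightarrow> nat set \<Rightarrow> real" where
  "Down_iter K k l f = foldr (Down K) [l + 1..<k + 1] f"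

definition HD_kernel :: "wcomplex \<Rightarrow> nat \<Rightarrow> (nat set \<Rightarrow> real) set" where
  "HD_kernel K l = (if l = 0 then cochains K 0 else {h \<in> cochains K l. Down K l h = (\<lambda>_. 0)})"

definition HD_space :: "wcomplex \<Rightarrow> nat \<Rightarrow> nat \<Rightarrow> (nat set \<Rightarrow> real) set" where
  "HD_space K k l = Up_iter K l k ` HD_kernel K l"

definition HD_level_set_decomposition ::
  "wcomplex \<Rightarrow> nat \<Rightarrow> (nat set \<Rightarrow> real) \<Rightarrow> (nat \<Rightarrow> nat set \<Rightarrow> real) \<Rightarrow> bool" where
  "HD_level_set_decomposition K k f fs \<longleftrightarrow>
     (\<forall>j\<le>k. fs j \<in> HD_space K k j) \<and> f = (\<lambda>x. \<Sum>j\<le>k. fs j x)"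

end

theory Submission
  imports Defs "HOL-Analysis.Analysis"
begin

text \<open>
  On each link the walk minus its stationary part has operator norm at most \<open>\<gamma>\<close>, since the extremal
  values of its Rayleigh quotient are nontrivial eigenvalues. Averaging over the links gives
  \<open>\<parallel>D\<^sub>i\<^sub>+\<^sub>1 U\<^sub>i - I/(i+1) - i/(i+1) U\<^sub>i\<^sub>-\<^sub>1 D\<^sub>i\<parallel> \<le> \<gamma>\<close>. For \<open>g \<in> Ker D\<^sub>j\<close> this relation, applied
  repeatedly, moves \<open>D\<close> past \<open>U\<close> and shows that \<open>D\<^sup>k\<^sub>l U\<^sup>k\<^sub>j g\<close> is within \<open>k\<^sup>2 \<gamma> \<parallel>g\<parallel>\<close> of
  \<open>binom(l,j)/binom(k,j) U\<^sup>l\<^sub>j g\<close>. Consequently the levels \<open>f\<^sub>j = U\<^sup>k\<^sub>j g\<^sub>j\<close> are almost orthogonal with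
  \<open>\<parallel>f\<^sub>j\<parallel>\<^sup>2\<close> about \<open>\<parallel>g\<^sub>j\<parallel>\<^sup>2 / binom(k,j)\<close>, so \<open>\<Sum>\<^sub>j \<parallel>g\<^sub>j\<parallel>\<^sup>2 \<le> 2\<^sup>k\<^sup>+\<^sup>1 \<parallel>f\<parallel>\<^sup>2\<close> for small \<open>\<gamma>\<close>. Expanding
  \<open>\<parallel>D\<^sup>k\<^sub>l f\<parallel>\<^sup>2 = \<Sum>\<^sub>j \<langle>D\<^sup>k\<^sub>l f, D\<^sup>k\<^sub>l f\<^sub>j\<rangle>\<close> gives the formula; the term \<open>j = 0\<close> is exactly the squared mean.
\<close>

section \<open>Extremal eigenvalues of a weighted symmetric form\<close>

text \<open>Functions live on the whole type, so they are pinned to zero off \<open>V\<close>. The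
  weighted unit sphere is then a closed subset of a product of compact intervals, and Tychonoff's
  theorem applies.\<close>

lemma weighted_sphere_compact:
  fixes w :: "'a \<Rightarrow> real"
  assumes fin: "finite V" and w: "\<And>u. u \<in> V \<Longrightarrow> w u > 0"
  shows "compact {g. (\<forall>u. u \<notin> V \<longrightarrow> g u = 0) \<and> (\<Sum>u\<in>V. w u * (g u)\<^sup>2) = 1}"
proof -
  \<comment> \<open>On the sphere \<open>(g u)^2\<close> is at most \<open>1 / w u\<close>; the
    larger radius \<open>1 + 1 / w u\<close> bounds the absolute value without a square
    root.\<close>
  define B where "B u = (if u \<in> V then {- (1 + 1 / w u)..1 + 1 / w u} else {0::real})" for u
  have "compact (PiE UNIV B)"
    using compactin_PiE[of "\<lambda>_. euclidean" UNIV B]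
    by (auto simp: euclidean_product_topology B_def)
  moreover have "closed {g::'a \<Rightarrow> real. (\<Sum>u\<in>V. w u * (g u)\<^sup>2) = 1}"
    by (intro closed_Collect_eq continuous_intros continuous_on_product_coordinates)
  ultimately have "compact (PiE UNIV B \<inter> {g. (\<Sum>u\<in>V. w u * (g u)\<^sup>2) = 1})"
    by (rule compact_Int_closed)
  moreover have "{g. (\<forall>u. u \<notin> V \<longrightarrow> g u = 0) \<and> (\<Sum>u\<in>V. w u * (g u)\<^sup>2) = 1}
      = PiE UNIV B \<inter> {g. (\<Sum>u\<in>V. w u * (g u)\<^sup>2) = 1}"
  proof -
    have "g u \<in> B u"
      if g: "\<forall>u. u \<notin> V \<longrightarrow> g u = 0" "(\<Sum>u\<in>V. w u * (g u)\<^sup>2) = 1" for g u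
    proof (cases "u \<in> V")
      case True
      have "w u * (g u)\<^sup>2 \<le> (\<Sum>u\<in>V. w u * (g u)\<^sup>2)"
        by (intro member_le_sum[OF True _ fin]) (simp add: w less_imp_le)
      then have "(g u)\<^sup>2 \<le> 1 / w u"
        using g w[OF True] by (simp add: field_simps)
      also have "\<dots> \<le> (1 + 1 / w u)\<^sup>2"
        using w[OF True] by (simp add: power2_eq_square field_simps)
      finally have "\<bar>g u\<bar> \<le> 1 + 1 / w u"
        using w[OF True] by (simp add: add_nonneg_nonneg flip: abs_le_square_iff)
      then show ?thesis using True by (auto simp: B_def abs_le_iff)
    qed (use g in \<open>auto simp: B_def\<close>)
    moreover have "g u = 0" if "g \<in> PiE UNIV B" "u \<notin> V" for g u
      using PiE_mem[OF that(1), of u] that(2) by (simp add: B_def)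
    ultimately show ?thesis by (auto simp: PiE_UNIV_domain)
  qed
  ultimately show ?thesis by simp
qed

text \<open>For small \<open>t\<close> the linear term decides the sign. This is the first-order
  condition at an extremum.\<close>

lemma linear_coeff_zero:
  fixes a b :: real
  assumes "\<And>t. 0 \<le> t * a + t\<^sup>2 * b"
  shows "a = 0"
proof (rule ccontr)
  assume "a \<noteq> 0"
  \<comment> \<open>The sign is opposite to that of \<open>a\<close>, and the denominator exceeds
    \<bar>b\<bar>, so the quadratic term cannot make up for the negative linear one.\<close>
  define t where "t = - a / (1 + \<bar>b\<bar>)"
  have "t * a + t\<^sup>2 * b = (a\<^sup>2 / (1 + \<bar>b\<bar>)\<^sup>2) * (b - (1 + \<bar>b\<bar>))"
    by (simp add: t_def power2_eq_square divide_simps) (simp add: algebra_simps)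
  also have "\<dots> < 0"
    using \<open>a \<noteq> 0\<close> by (intro mult_pos_neg) auto
  finally show False using assms[of t] by simp
qed

text \<open>A maximiser of the Rayleigh quotient is an eigenvector.\<close>

lemma top_eigenpair:
  fixes w :: "'a \<Rightarrow> real" and m :: "'a \<Rightarrow> 'a \<Rightarrow> real"
  assumes fin: "finite V" and ne: "V \<noteq> {}" and w: "\<And>u. u \<in> V \<Longrightarrow> w u > 0"
    and sym: "\<And>u v. u \<in> V \<Longrightarrow> v \<in> V \<Longrightarrow> m u v = m v u"
  shows "\<exists>\<mu> g. (\<exists>u\<in>V. g u \<noteq> 0) \<and>
    (\<forall>u\<in>V. (\<Sum>v\<in>V. m u v * g v) = \<mu> * (w u * g u)) \<and>
    (\<forall>h. (\<Sum>u\<in>V. \<Sum>v\<in>V. m u v * h u * h v) \<le> \<mu> * (\<Sum>u\<in>V. w u * (h u)\<^sup>2))"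
proof -
  define N where "N h = (\<Sum>u\<in>V. w u * (h u)\<^sup>2)" for h
  define Q where "Q h = (\<Sum>u\<in>V. \<Sum>v\<in>V. m u v * h u * h v)" for h
  define S where "S = {g. (\<forall>u. u \<notin> V \<longrightarrow> g u = 0) \<and> N g = 1}"
  have comp: "compact S"
    unfolding S_def N_def using fin w by (rule weighted_sphere_compact)
  obtain a where a: "a \<in> V" using ne by auto
  have N_single: "N (\<lambda>u. if u = x then c else 0) = w x * c\<^sup>2" if "x \<in> V" for x c
    using that fin unfolding N_def by (simp add: if_distrib[of "\<lambda>z. z\<^sup>2"] if_distrib[of "\<lambda>z. w _ * z"] cong: if_cong)
  have "(\<lambda>u. if u = a then 1 / sqrt (w a) else 0) \<in> S"
    using a w[OF a] unfolding S_def by (auto simp: N_single power_divide)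
  then have "S \<noteq> {}" by blast
  moreover have "continuous_on S Q"
    unfolding Q_def
    by (intro continuous_intros continuous_on_subset[OF continuous_on_product_coordinates]) auto
  ultimately obtain g where g: "g \<in> S" and max: "\<And>h. h \<in> S \<Longrightarrow> Q h \<le> Q g"
    using continuous_attains_sup[OF comp] by blast
  have N_scale: "N (\<lambda>u. c * h u) = c\<^sup>2 * N h" for c h
    unfolding N_def by (simp add: sum_distrib_left power_mult_distrib algebra_simps)
  have Q_scale: "Q (\<lambda>u. c * h u) = c\<^sup>2 * Q h" for c h
    unfolding Q_def by (simp add: sum_distrib_left power2_eq_square algebra_simps)
  have le: "Q h \<le> Q g * N h" for h
  proof (cases "\<exists>u\<in>V. h u \<noteq> 0")
    case False
    then show ?thesis by (simp add: Q_def N_def)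
  next
    case True
    then obtain u where u: "u \<in> V" "h u \<noteq> 0" by blast
    have "0 < w u * (h u)\<^sup>2" using u w by simp
    also have "\<dots> \<le> N h"
      unfolding N_def by (intro member_le_sum[OF u(1) _ fin]) (simp add: w less_imp_le)
    finally have pos: "N h > 0" .
    \<comment> \<open>Cutting \<open>h\<close> off outside \<open>V\<close> changes neither form and
      lets the normalised function lie in \<open>S\<close>.\<close>
    define h' where "h' u = (if u \<in> V then h u else 0)" for u
    have eqs: "N h' = N h" "Q h' = Q h" by (simp_all add: N_def Q_def h'_def)
    define c where "c = 1 / sqrt (N h)"
    have "c\<^sup>2 * N h = 1" using pos by (simp add: c_def power_divide)
    then have "(\<lambda>u. c * h' u) \<in> S"
      unfolding S_def by (auto simp: N_scale eqs) (simp add: h'_def)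
    then have "c\<^sup>2 * Q h \<le> Q g" using max Q_scale eqs by metis
    then have "c\<^sup>2 * Q h * N h \<le> Q g * N h" using pos by (simp add: mult_right_mono)
    then show ?thesis using \<open>c\<^sup>2 * N h = 1\<close> by (metis mult.assoc mult.commute mult.right_neutral)
  qed
  have Ng: "N g = 1" using g by (simp add: S_def)
  have eigen: "(\<Sum>v\<in>V. m x v * g v) = Q g * (w x * g x)" if x: "x \<in> V" for x
  proof -
    \<comment> \<open>Along the coordinate direction \<open>x\<close> the difference
      \<open>Q g * N - Q\<close> stays nonnegative and is zero at \<open>t = 0\<close>, since
      \<open>N g = 1\<close>. Its linear coefficient in \<open>t\<close> therefore vanishes, which
      is the eigenvector equation at \<open>x\<close>.\<close>
    define e where "e u = (if u = x then 1 else 0 :: real)" for u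
    have mx: "(\<Sum>v\<in>V. m x v * e v) = m x x"
      using x fin by (simp add: e_def if_distrib cong: if_cong)
    have Ne: "N (\<lambda>u. g u + t * e u) = N g + t * (2 * (w x * g x)) + t\<^sup>2 * w x" for t
    proof -
      have "N (\<lambda>u. g u + t * e u)
          = (\<Sum>u\<in>V. w u * (g u)\<^sup>2 + (if u = x then t * (2 * (w x * g x)) + t\<^sup>2 * w x else 0))"
        unfolding N_def e_def by (intro sum.cong) (auto simp: power2_eq_square algebra_simps)
      then show ?thesis using x fin by (simp add: N_def sum.distrib)
    qed
    have Qe: "Q (\<lambda>u. g u + t * e u) = Q g + t * (2 * (\<Sum>v\<in>V. m x v * g v)) + t\<^sup>2 * m x x" for t
    proof -
      have "Q (\<lambda>u. g u + t * e u)
          = (\<Sum>u\<in>V. \<Sum>v\<in>V. m u v * g u * g v + t * (m u v * g u * e v)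
              + e u * (t * (m u v * g v) + t\<^sup>2 * (m u v * e v)))"
        unfolding Q_def by (intro sum.cong refl) (simp add: power2_eq_square algebra_simps)
      also have "\<dots> = Q g + t * (\<Sum>u\<in>V. \<Sum>v\<in>V. m u v * g u * e v)
          + (\<Sum>u\<in>V. e u * (\<Sum>v\<in>V. t * (m u v * g v) + t\<^sup>2 * (m u v * e v)))"
        by (simp only: Q_def sum.distrib flip: sum_distrib_left)
      also have "(\<Sum>u\<in>V. \<Sum>v\<in>V. m u v * g u * e v) = (\<Sum>u\<in>V. m x u * g u)"
        using x fin sym by (intro sum.cong refl) (simp add: e_def if_distrib sum.delta cong: if_cong)
      also have "(\<Sum>u\<in>V. e u * (\<Sum>v\<in>V. t * (m u v * g v) + t\<^sup>2 * (m u v * e v)))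
          = (\<Sum>v\<in>V. t * (m x v * g v) + t\<^sup>2 * (m x v * e v))"
        using x fin by (simp add: e_def if_distrib[of "\<lambda>z. z * _"] sum.delta cong: if_cong)
      also have "\<dots> = t * (\<Sum>v\<in>V. m x v * g v) + t\<^sup>2 * m x x"
        by (simp only: sum.distrib mx flip: sum_distrib_left)
      finally show ?thesis by (simp add: algebra_simps)
    qed
    have "0 \<le> t * (2 * (Q g * (w x * g x)) - 2 * (\<Sum>v\<in>V. m x v * g v)) + t\<^sup>2 * (Q g * w x - m x x)"
      for t
      using le[of "\<lambda>u. g u + t * e u"] unfolding Ne Qe Ng by (simp add: algebra_simps)
    from linear_coeff_zero[OF this] show ?thesis by simp
  qed
  have "\<exists>u\<in>V. g u \<noteq> 0"
  proof (rule ccontr)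
    assume "\<not> (\<exists>u\<in>V. g u \<noteq> 0)"
    then have "N g = 0" by (simp add: N_def)
    then show False using Ng by simp
  qed
  then show ?thesis
    using eigen le unfolding Q_def N_def by (intro exI[of _ "\<Sum>u\<in>V. \<Sum>v\<in>V. m u v * g u * g v"] exI[of _ g]) simp
qed

text \<open>The maxima of the Rayleigh quotients of \<open>m\<close> and of \<open>- m\<close> are,
  up to sign, eigenvalues of \<open>m\<close>. A bound on all eigenvalues thus bounds the form from
  both sides, without a full spectral decomposition.\<close>

lemma symmetric_form_bound:
  fixes w :: "'a \<Rightarrow> real" and m :: "'a \<Rightarrow> 'a \<Rightarrow> real"
  assumes fin: "finite V" and w: "\<And>u. u \<in> V \<Longrightarrow> w u > 0"
    and sym: "\<And>u v. u \<in> V \<Longrightarrow> v \<in> V \<Longrightarrow> m u v = m v u"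
    and eig: "\<And>\<mu> g. \<lbrakk>\<exists>u\<in>V. g u \<noteq> 0; \<And>u. u \<in> V \<Longrightarrow> (\<Sum>v\<in>V. m u v * g v) = \<mu> * (w u * g u)\<rbrakk>
        \<Longrightarrow> \<bar>\<mu>\<bar> \<le> c"
  shows "\<bar>\<Sum>u\<in>V. \<Sum>v\<in>V. m u v * h u * h v\<bar> \<le> c * (\<Sum>u\<in>V. w u * (h u)\<^sup>2)"
proof (cases "V = {}")
  case False
  have nonneg: "0 \<le> (\<Sum>u\<in>V. w u * (h u)\<^sup>2)"
    by (intro sum_nonneg) (simp add: w less_imp_le)
  have "(\<Sum>u\<in>V. \<Sum>v\<in>V. m u v * h u * h v) \<le> c * (\<Sum>u\<in>V. w u * (h u)\<^sup>2)"
  proof -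
    from fin False w sym have "\<exists>\<mu> g. (\<exists>u\<in>V. g u \<noteq> 0) \<and>
        (\<forall>u\<in>V. (\<Sum>v\<in>V. m u v * g v) = \<mu> * (w u * g u)) \<and>
        (\<forall>h. (\<Sum>u\<in>V. \<Sum>v\<in>V. m u v * h u * h v) \<le> \<mu> * (\<Sum>u\<in>V. w u * (h u)\<^sup>2))"
      by (rule top_eigenpair)
    then obtain \<mu> g where "\<exists>u\<in>V. g u \<noteq> 0"
      "\<forall>u\<in>V. (\<Sum>v\<in>V. m u v * g v) = \<mu> * (w u * g u)"
      and le: "\<forall>h. (\<Sum>u\<in>V. \<Sum>v\<in>V. m u v * h u * h v) \<le> \<mu> * (\<Sum>u\<in>V. w u * (h u)\<^sup>2)"
      by (elim exE conjE)
    then have "\<mu> \<le> c" using eig[of g \<mu>] by simp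
    then show ?thesis using le[rule_format, of h] nonneg by (meson mult_right_mono order_trans)
  qed
  moreover have "- (\<Sum>u\<in>V. \<Sum>v\<in>V. m u v * h u * h v) \<le> c * (\<Sum>u\<in>V. w u * (h u)\<^sup>2)"
  proof -
    have "- m u v = - m v u" if "u \<in> V" "v \<in> V" for u v
      using sym[OF that] by simp
    from fin False w this have "\<exists>\<mu> g. (\<exists>u\<in>V. g u \<noteq> 0) \<and>
        (\<forall>u\<in>V. (\<Sum>v\<in>V. - m u v * g v) = \<mu> * (w u * g u)) \<and>
        (\<forall>h. (\<Sum>u\<in>V. \<Sum>v\<in>V. - m u v * h u * h v) \<le> \<mu> * (\<Sum>u\<in>V. w u * (h u)\<^sup>2))"
      by (rule top_eigenpair)
    then obtain \<mu> g where g: "\<exists>u\<in>V. g u \<noteq> 0"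
      "\<forall>u\<in>V. (\<Sum>v\<in>V. - m u v * g v) = \<mu> * (w u * g u)"
      and le: "\<forall>h. (\<Sum>u\<in>V. \<Sum>v\<in>V. - m u v * h u * h v) \<le> \<mu> * (\<Sum>u\<in>V. w u * (h u)\<^sup>2)"
      by (elim exE conjE)
    have "(\<Sum>v\<in>V. m u v * g v) = - \<mu> * (w u * g u)" if "u \<in> V" for u
      using g(2)[rule_format, OF that] unfolding mult_minus_left sum_negf by linarith
    then have "\<mu> \<le> c" using eig[of g "- \<mu>"] g(1) by simp
    then have "(\<Sum>u\<in>V. \<Sum>v\<in>V. - m u v * h u * h v) \<le> c * (\<Sum>u\<in>V. w u * (h u)\<^sup>2)"
      using le[rule_format, of h] nonneg by (meson mult_right_mono order_trans)
    then show ?thesis by (simp add: sum_negf)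
  qed
  ultimately show ?thesis by linarith
qed simp

section \<open>Weights of faces and the up and down operators\<close>

text \<open>The probability that a random facet contains \<open>x\<close>. It avoids the recursion
  in \<open>face_prob\<close>, from which it differs by a binomial coefficient only
  (\<open>face_prob_eq\<close>).\<close>

definition mass :: "wcomplex \<Rightarrow> nat set \<Rightarrow> real" where
  "mass K x = (\<Sum>t\<in>{t \<in> facets K. x \<subseteq> t}. facet_wt K t)"

text \<open>The vertices of the link of \<open>x\<close>. Indexing cofaces by the vertex they add
  turns sums over cofaces into sums over vertices.\<close>

definition ext :: "wcomplex \<Rightarrow> nat set \<Rightarrow> nat set" where
  "ext K x = {v. v \<notin> x \<and> insert v x \<in> faces K (Suc (card x))}"

locale weighted_cx =
  fixes n :: nat and K :: wcomplex
  assumes weighted: "weighted_complex n K"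
begin

abbreviation d :: nat where "d \<equiv> cdim K"

lemma facet_props:
  assumes "t \<in> facets K"
  shows "t \<subseteq> {1..n}" "finite t" "card t = d" "facet_wt K t > 0"
proof -
  show "t \<subseteq> {1..n}" "card t = d" "facet_wt K t > 0"
    using assms weighted unfolding weighted_complex_def by auto
  then show "finite t" using finite_subset by blast
qed

lemma finite_facets: "finite (facets K)"
  by (rule finite_subset[of _ "Pow {1..n}"]) (use facet_props in auto)

lemma face_iff: "x \<in> faces K i \<longleftrightarrow> card x = i \<and> (\<exists>t\<in>facets K. x \<subseteq> t)"
  by (simp add: faces_def)

lemma finite_faces [simp]: "finite (faces K i)"
  by (rule finite_subset[of _ "Pow {1..n}"]) (use facet_props in \<open>fastforce simp: faces_def\<close>)+

lemma finite_face: "x \<in> faces K i \<Longrightarrow> finite x"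
  using facet_props(2) by (auto simp: faces_def intro: finite_subset)

lemma card_face: "x \<in> faces K i \<Longrightarrow> card x = i"
  by (simp add: faces_def)

lemma finite_ext [simp]: "finite (ext K x)"
  by (rule finite_subset[of _ "{1..n}"]) (use facet_props(1) in \<open>fastforce simp: ext_def faces_def\<close>)+

lemma mass_pos: "x \<in> faces K i \<Longrightarrow> mass K x > 0"
  unfolding mass_def faces_def using facet_props(4) finite_facets
  by (intro sum_pos) auto

lemma ext_iff: "x \<in> faces K i \<Longrightarrow> v \<in> ext K x \<longleftrightarrow> v \<notin> x \<and> insert v x \<in> faces K (Suc i)"
  by (simp add: ext_def card_face)

lemma facets_nonempty: "facets K \<noteq> {}"
  using weighted unfolding weighted_complex_def by auto

lemma faces_0: "faces K 0 = {{}}"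
proof -
  have "x = {}" if "x \<in> faces K 0" for x
    using card_face[OF that] finite_face[OF that] by simp
  moreover have "{} \<in> faces K 0"
    using facets_nonempty by (auto simp: face_iff)
  ultimately show ?thesis by blast
qed

lemma mass_empty: "mass K {} = 1"
  using weighted by (simp add: mass_def weighted_complex_def)

text \<open>Double counting of pairs of a vertex and a facet: a facet \<open>t\<close> above
  \<open>x\<close> is counted once for each of the \<open>d - i\<close> vertices of
  \<open>t - x\<close>.\<close>

lemma sum_mass_ext:
  assumes x: "x \<in> faces K i"
  shows "(\<Sum>v\<in>ext K x. mass K (insert v x)) = real (d - i) * mass K x"
proof -
  have *: "{t \<in> facets K. insert v x \<subseteq> t} = {t \<in> {t \<in> facets K. x \<subseteq> t}. v \<in> t}" for v
    by auto
  have "(\<Sum>v\<in>ext K x. mass K (insert v x))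
      = (\<Sum>v\<in>ext K x. \<Sum>t\<in>{t \<in> {t \<in> facets K. x \<subseteq> t}. v \<in> t}. facet_wt K t)"
    unfolding mass_def * ..
  also have "\<dots> = (\<Sum>t\<in>{t \<in> facets K. x \<subseteq> t}. \<Sum>v\<in>{v \<in> ext K x. v \<in> t}. facet_wt K t)"
    using finite_facets by (intro sum.swap_restrict) auto
  also have "\<dots> = (\<Sum>t\<in>{t \<in> facets K. x \<subseteq> t}. real (d - i) * facet_wt K t)"
  proof (intro sum.cong refl)
    fix t assume t: "t \<in> {t \<in> facets K. x \<subseteq> t}"
    have "{v \<in> ext K x. v \<in> t} = t - x"
      using t x finite_face[OF x] by (auto simp: ext_iff face_iff)
    moreover have "card (t - x) = d - i"
      using t x finite_face[OF x] facet_props(3) by (simp add: card_Diff_subset card_face)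
    ultimately show "(\<Sum>v\<in>{v \<in> ext K x. v \<in> t}. facet_wt K t) = real (d - i) * facet_wt K t"
      by simp
  qed
  finally show ?thesis by (simp add: mass_def sum_distrib_left)
qed

lemma cofaces:
  assumes x: "x \<in> faces K i"
  shows "{y \<in> faces K (Suc i). x \<subset> y} = (\<lambda>v. insert v x) ` ext K x"
    and "inj_on (\<lambda>v. insert v x) (ext K x)"
proof -
  show "inj_on (\<lambda>v. insert v x) (ext K x)"
    by (auto simp: inj_on_def ext_def)
  have "y \<in> (\<lambda>v. insert v x) ` ext K x" if y: "y \<in> faces K (Suc i)" "x \<subset> y" for y
  proof -
    have "card (y - x) = 1"
      using y card_face[OF x] card_face[OF y(1)] finite_face[OF x]
      by (simp add: card_Diff_subset psubset_eq)
    then obtain v where "y - x = {v}" by (auto simp: card_1_singleton_iff)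
    then have "y = insert v x" "v \<notin> x" using y by auto
    then show ?thesis using y x by (auto simp: ext_iff)
  qed
  then show "{y \<in> faces K (Suc i). x \<subset> y} = (\<lambda>v. insert v x) ` ext K x"
    using x by (auto simp: ext_iff)
qed

lemma binomial_step: "i < d \<Longrightarrow> real (d - i) * real (d choose i) = real (Suc i) * real (d choose Suc i)"
  by (metis Suc_times_binomial_add binomial_absorb_comp binomial_absorption mult.commute of_nat_mult)

text \<open>Downward induction from level \<open>d\<close>, where a face lies in no facet but
  itself. In the step \<open>sum_mass_ext\<close> evaluates the recursive sum and
  \<open>binomial_step\<close> adjusts the normalisation.\<close>

lemma face_prob_eq:
  assumes "i \<le> d" "x \<in> faces K i"
  shows "face_prob K i x = mass K x / real (d choose i)"
  using assms
proof (induction i arbitrary: x rule: inc_induct)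
  case base
  have "t = x" if "t \<in> facets K" "x \<subseteq> t" for t
    using that facet_props base by (metis card_face card_subset_eq)
  then have "{t \<in> facets K. x \<subseteq> t} = {x}"
    using base by (auto simp: face_iff)
  then show ?case by (simp add: mass_def face_prob.simps)
next
  case (step i)
  have i: "i < d" using step.hyps by simp
  have "face_prob K i x = 1 / real (i + 1) * (\<Sum>y\<in>{y \<in> faces K (i + 1). x \<subset> y}. face_prob K (i + 1) y)"
    using i by (subst face_prob.simps) simp
  also have "(\<Sum>y\<in>{y \<in> faces K (i + 1). x \<subset> y}. face_prob K (i + 1) y)
      = (\<Sum>y\<in>{y \<in> faces K (Suc i). x \<subset> y}. mass K y / real (d choose Suc i))"
    using step.IH by (intro sum.cong) auto
  also have "\<dots> = real (d - i) * mass K x / real (d choose Suc i)"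
    unfolding cofaces(1)[OF step.prems] sum.reindex[OF cofaces(2)[OF step.prems]]
    by (simp add: sum_mass_ext[OF step.prems] flip: sum_divide_distrib)
  finally have "face_prob K i x = real (d - i) * mass K x / (real (Suc i) * real (d choose Suc i))"
    by simp
  then show ?case
    unfolding binomial_step[OF i, symmetric] using i by simp
qed

lemma face_prob_pos: "i \<le> d \<Longrightarrow> x \<in> faces K i \<Longrightarrow> face_prob K i x > 0"
  by (simp add: face_prob_eq mass_pos)

lemma face_delete: "\<lbrakk>y \<in> faces K (Suc i); v \<in> y\<rbrakk> \<Longrightarrow> y - {v} \<in> faces K i"
  by (auto simp: face_iff)

text \<open>Both sides run over the flags formed by a face \<open>x\<close> and a coface
  \<open>insert v x\<close>. This is the double counting behind each exchange of sums between levels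
  \<open>i\<close> and \<open>Suc i\<close>.\<close>

lemma flag_reindex:
  "(\<Sum>y\<in>faces K (Suc i). \<Sum>v\<in>y. F (y - {v}) v) = (\<Sum>x\<in>faces K i. \<Sum>v\<in>ext K x. F x v)"
proof -
  have "(\<Sum>y\<in>faces K (Suc i). \<Sum>v\<in>y. F (y - {v}) v)
      = (\<Sum>(y, v)\<in>Sigma (faces K (Suc i)) (\<lambda>y. y). F (y - {v}) v)"
    by (rule sum.Sigma) (auto intro: finite_face)
  also have "\<dots> = (\<Sum>(x, v)\<in>Sigma (faces K i) (ext K). F x v)"
    by (rule sum.reindex_bij_witness[of _ "\<lambda>(x, v). (insert v x, v)" "\<lambda>(y, v). (y - {v}, v)"])
      (auto simp: ext_iff[OF face_delete] ext_iff insert_absorb face_delete)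
  also have "\<dots> = (\<Sum>x\<in>faces K i. \<Sum>v\<in>ext K x. F x v)"
    by (rule sum.Sigma[symmetric]) auto
  finally show ?thesis .
qed

section \<open>The up and down operators in terms of vertices, and their adjointness\<close>

lemma Up_eq:
  assumes y: "y \<in> faces K (Suc i)"
  shows "Up K i h y = (\<Sum>v\<in>y. h (y - {v})) / real (Suc i)"
proof -
  have "{x \<in> faces K i. x \<subset> y} = (\<lambda>v. y - {v}) ` y"
  proof (intro equalityI subsetI)
    fix x assume x: "x \<in> {x \<in> faces K i. x \<subset> y}"
    have "card (y - x) = 1"
      using x card_face[OF y] card_face[of x i] finite_face[of x i]
      by (simp add: card_Diff_subset psubset_eq)
    then obtain v where "y - x = {v}" by (auto simp: card_1_singleton_iff)
    then have "x = y - {v}" "v \<in> y" using x by auto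
    then show "x \<in> (\<lambda>v. y - {v}) ` y" by auto
  qed (use y finite_face[OF y] in \<open>auto simp: face_iff\<close>)
  moreover have "inj_on (\<lambda>v. y - {v}) y" by (auto simp: inj_on_def)
  ultimately show ?thesis using y by (simp add: Up_def sum.reindex)
qed

text \<open>The level-dependent normalisations cancel and leave a weighted average over added
  vertices; by \<open>sum_mass_ext\<close> its weights add up to one.\<close>

lemma Down_eq:
  assumes x: "x \<in> faces K i" and i: "i < d"
  shows "Down K (Suc i) f x
    = (\<Sum>v\<in>ext K x. mass K (insert v x) * f (insert v x)) / (real (d - i) * mass K x)"
proof -
  have "Down K (Suc i) f x = 1 / real (Suc i) * (\<Sum>y\<in>{y \<in> faces K (Suc i). x \<subset> y}.
      (mass K y / real (d choose Suc i)) / (mass K x / real (d choose i)) * f y)"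
    using x i by (simp add: Down_def face_prob_eq)
  also have "\<dots> = 1 / real (Suc i) * (\<Sum>v\<in>ext K x.
      (mass K (insert v x) / real (d choose Suc i)) / (mass K x / real (d choose i)) * f (insert v x))"
    unfolding cofaces(1)[OF x] sum.reindex[OF cofaces(2)[OF x]] by simp
  also have "\<dots> = (\<Sum>v\<in>ext K x. mass K (insert v x) * f (insert v x))
      * (real (d choose i) / (real (Suc i) * real (d choose Suc i) * mass K x))"
    by (simp add: sum_distrib_left sum_distrib_right sum_divide_distrib mult_ac)
  also have "real (d choose i) / (real (Suc i) * real (d choose Suc i) * mass K x)
      = 1 / (real (d - i) * mass K x)"
    unfolding binomial_step[OF i, symmetric] using i by simp
  finally show ?thesis by simp
qed

lemma face_ip_eq:
  "i \<le> d \<Longrightarrow> face_ip K i f g = (\<Sum>x\<in>faces K i. mass K x * (f x * g x)) / real (d choose i)"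
  by (simp add: face_ip_def face_expect_def face_prob_eq sum_divide_distrib)

lemma face_ip_commute: "face_ip K i f g = face_ip K i g f"
  by (simp add: face_ip_def mult.commute)

text \<open>Up to normalisation both sides are the sum of \<open>mass K y * g y * h x\<close> over
  all flags of \<open>x\<close> below \<open>y\<close>; \<open>binomial_step\<close> matches the
  normalisations.\<close>

lemma Up_Down_adjoint:
  assumes i: "i < d"
  shows "face_ip K (Suc i) (Up K i h) g = face_ip K i h (Down K (Suc i) g)"
proof -
  have "(\<Sum>y\<in>faces K (Suc i). mass K y * (Up K i h y * g y))
      = (\<Sum>y\<in>faces K (Suc i). \<Sum>v\<in>y. (\<lambda>x v. mass K (insert v x) * g (insert v x) * h x) (y - {v}) v)
          / real (Suc i)"
    by (simp add: Up_eq sum_divide_distrib sum_distrib_left sum_distrib_right insert_absorb mult_ac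
        cong: sum.cong)
  also have "\<dots> = (\<Sum>x\<in>faces K i. \<Sum>v\<in>ext K x. mass K (insert v x) * g (insert v x) * h x)
      / real (Suc i)"
    by (simp only: flag_reindex[of "\<lambda>x v. mass K (insert v x) * g (insert v x) * h x" i])
  also have "\<dots> = (\<Sum>x\<in>faces K i. real (d - i) * (mass K x * (h x * Down K (Suc i) g x))) / real (Suc i)"
  proof -
    have "(\<Sum>v\<in>ext K x. mass K (insert v x) * g (insert v x) * h x)
        = real (d - i) * (mass K x * (h x * Down K (Suc i) g x))" if x: "x \<in> faces K i" for x
      using mass_pos[OF x] i
      by (simp add: Down_eq[OF x i]) (simp add: sum_distrib_left mult_ac)
    then show ?thesis by simp
  qed
  finally have "(\<Sum>y\<in>faces K (Suc i). mass K y * (Up K i h y * g y))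
      = real (d - i) / real (Suc i) * (\<Sum>x\<in>faces K i. mass K x * (h x * Down K (Suc i) g x))"
    by (simp add: sum_distrib_left sum_divide_distrib)
  moreover have "real (d - i) / real (Suc i) / real (d choose Suc i) = 1 / real (d choose i)"
    using binomial_step[OF i] i by (simp add: divide_simps)
  moreover have "a * b / c = b / e" if "a / c = 1 / e" for a b c e :: real
    using arg_cong[OF that, of "\<lambda>z. z * b"] by (simp add: mult.commute)
  ultimately show ?thesis using i by (simp only: face_ip_eq less_imp_le Suc_leI)
qed

end

section \<open>From links to the complex\<close>

context weighted_cx
begin

lemma link_facets:
  "facets (face_link K s) = (\<lambda>t. t - s) ` {t \<in> facets K. s \<subseteq> t}"
  "inj_on (\<lambda>t. t - s) {t \<in> facets K. s \<subseteq> t}"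
  "\<lbrakk>t \<in> facets K; s \<subseteq> t\<rbrakk> \<Longrightarrow> facet_wt (face_link K s) (t - s) = facet_wt K t / mass K s"
  by (auto simp: face_link_def inj_on_def mass_def Un_absorb1)

lemma link_dim: "s \<in> faces K j \<Longrightarrow> cdim (face_link K s) = d - j"
  by (simp add: face_link_def card_face)

lemma link_face_iff:
  "x \<in> faces (face_link K s) i \<longleftrightarrow> card x = i \<and> x \<inter> s = {} \<and> (\<exists>t\<in>facets K. s \<union> x \<subseteq> t)"
  unfolding faces_def link_facets by auto

text \<open>Makes the theory of weighted complexes, in particular the formula for
  \<open>face_prob\<close>, available inside links.\<close>

lemma link_weighted:
  assumes s: "s \<in> faces K j"
  shows "weighted_complex n (face_link K s)"
  unfolding weighted_complex_def link_facets(1) link_dim[OF s]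
proof (intro conjI ballI)
  fix t assume "t \<in> (\<lambda>t. t - s) ` {t \<in> facets K. s \<subseteq> t}"
  then obtain t' where t': "t = t' - s" "t' \<in> facets K" "s \<subseteq> t'" by auto
  show "t \<subseteq> {1..n}" using t' facet_props(1) by blast
  show "card t = d - j"
    using t' finite_face[OF s] card_face[OF s] facet_props(3) by (simp add: card_Diff_subset)
  show "0 < facet_wt (face_link K s) t"
    using t' facet_props(4) mass_pos[OF s] by (simp add: link_facets(3))
next
  have "(\<Sum>t\<in>{t \<in> facets K. s \<subseteq> t}. facet_wt (face_link K s) (t - s)) = mass K s / mass K s"
    by (simp add: link_facets(3) mass_def[of K s] flip: sum_divide_distrib)
  then show "(\<Sum>t\<in>(\<lambda>t. t - s) ` {t \<in> facets K. s \<subseteq> t}. facet_wt (face_link K s) t) = 1"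
    using mass_pos[OF s] by (simp add: sum.reindex[OF link_facets(2)])
qed

text \<open>A conditional probability: the facets of the link that contain \<open>x\<close> come
  from the facets of \<open>K\<close> that contain \<open>s\<close> and \<open>x\<close>, and
  dividing by \<open>mass K s\<close> conditions on \<open>s\<close>.\<close>

lemma link_mass:
  assumes "x \<inter> s = {}"
  shows "mass (face_link K s) x = mass K (s \<union> x) / mass K s"
proof -
  have *: "{t \<in> (\<lambda>t. t - s) ` {t \<in> facets K. s \<subseteq> t}. x \<subseteq> t} = (\<lambda>t. t - s) ` {t \<in> facets K. s \<union> x \<subseteq> t}"
    using assms by auto
  have "inj_on (\<lambda>t. t - s) {t \<in> facets K. s \<union> x \<subseteq> t}"
    by (rule inj_on_subset[OF link_facets(2)]) auto
  then show ?thesis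
    unfolding mass_def[of "face_link K s"] link_facets(1) *
    by (simp add: sum.reindex link_facets(3) mass_def[of K "s \<union> x"] sum_divide_distrib)
qed

text \<open>Phrased through a facet containing both vertices, so that the roles of \<open>u\<close>
  and \<open>v\<close> can be exchanged; this makes the adjacency matrix of a link
  symmetric.\<close>

lemma ext_insert_iff:
  assumes s: "s \<in> faces K j" and u: "u \<in> ext K s"
  shows "v \<in> ext K (insert u s) \<longleftrightarrow> v \<notin> s \<and> v \<noteq> u \<and> (\<exists>t\<in>facets K. insert v (insert u s) \<subseteq> t)"
proof -
  have us: "insert u s \<in> faces K (Suc j)" using s u by (simp add: ext_iff)
  show ?thesis
    using finite_face[OF us] card_face[OF us] by (auto simp: ext_iff[OF us] face_iff)
qed

lemma link_skeleton:
  assumes s: "s \<in> faces K j"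
  shows "skeleton_vertices (face_link K s) = ext K s"
    and "u \<in> ext K s \<Longrightarrow> {v. {u, v} \<in> faces (face_link K s) 2} = ext K (insert u s)"
proof -
  show "skeleton_vertices (face_link K s) = ext K s"
  proof (intro set_eqI)
    fix v
    have "s \<union> {v} = insert v s" by auto
    then show "v \<in> skeleton_vertices (face_link K s) \<longleftrightarrow> v \<in> ext K s"
      using finite_face[OF s] card_face[OF s]
      by (simp add: skeleton_vertices_def link_face_iff ext_iff[OF s] face_iff cong: conj_cong)
  qed
  show "{v. {u, v} \<in> faces (face_link K s) 2} = ext K (insert u s)" if u: "u \<in> ext K s"
  proof (intro set_eqI)
    fix v
    have "card {u, v} = 2 \<longleftrightarrow> v \<noteq> u" by (cases "v = u") auto
    moreover have "u \<notin> s" using u by (simp add: ext_def)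
    moreover have "s \<union> {u, v} = insert v (insert u s)" by auto
    ultimately show "v \<in> {v. {u, v} \<in> faces (face_link K s) 2} \<longleftrightarrow> v \<in> ext K (insert u s)"
      unfolding ext_insert_iff[OF s u] by (simp add: link_face_iff) blast
  qed
qed

text \<open>All edge probabilities of the link are masses divided by one constant \<open>c\<close>,
  which cancels in the quotient. The degree of \<open>u\<close> comes from
  \<open>sum_mass_ext\<close> at \<open>insert u s\<close>, so the walk is reversible for the
  weights \<open>mass K (insert u s)\<close>.\<close>

lemma link_walk:
  assumes s: "s \<in> faces K j" and j: "j + 2 \<le> d" and u: "u \<in> ext K s"
  shows "skeleton_walk (face_link K s) g u
    = (\<Sum>v\<in>ext K (insert u s). mass K (insert v (insert u s)) * g v)
        / (real (d - Suc j) * mass K (insert u s))"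
proof -
  interpret L: weighted_cx n "face_link K s"
    using link_weighted[OF s] by unfold_locales
  define c where "c = mass K s * real ((d - j) choose 2)"
  have "c > 0" using mass_pos[OF s] j by (simp add: c_def)
  have "face_prob (face_link K s) 2 {u, v} = mass K (insert v (insert u s)) / c"
    if v: "v \<in> ext K (insert u s)" for v
  proof -
    have f: "{u, v} \<in> faces (face_link K s) 2" using v link_skeleton(2)[OF s u] by auto
    have "s \<union> {u, v} = insert v (insert u s)" by auto
    moreover have "{u, v} \<inter> s = {}" using f by (simp add: link_face_iff)
    ultimately show ?thesis
      using L.face_prob_eq[OF _ f] j by (simp add: link_dim[OF s] link_mass c_def)
  qed
  then have "skeleton_walk (face_link K s) g u
    = ((\<Sum>v\<in>ext K (insert u s). mass K (insert v (insert u s)) * g v) / c)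
        / ((\<Sum>v\<in>ext K (insert u s). mass K (insert v (insert u s))) / c)"
    unfolding skeleton_walk_def link_skeleton(2)[OF s u] by (simp add: sum_divide_distrib)
  moreover have "insert u s \<in> faces K (Suc j)" using s u by (simp add: ext_iff)
  ultimately show ?thesis using \<open>c > 0\<close> by (simp add: sum_mass_ext)
qed

end

section \<open>Spectral bounds on links and their average over the complex\<close>

locale expander = weighted_cx +
  fixes \<gamma> :: real
  assumes \<gamma>_nonneg: "0 \<le> \<gamma>" and expander: "two_sided_local_spectral_expander K \<gamma>"
begin

text \<open>
  The matrix is the adjacency form of the link minus its trivial part. Its rows sum to zero, so an
  eigenvector with nonzero eigenvalue is orthogonal to the constants, hence not constant.
\<close>

lemma link_form_bound:
  assumes s: "s \<in> faces K j" and j: "j + 2 \<le> d"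
  shows "\<bar>(\<Sum>u\<in>ext K s. \<Sum>v\<in>ext K (insert u s). mass K (insert v (insert u s)) * (h u * h v)) / real (d - Suc j)
      - (\<Sum>u\<in>ext K s. mass K (insert u s) * h u)\<^sup>2 / (real (d - j) * mass K s)\<bar>
    \<le> \<gamma> * (\<Sum>u\<in>ext K s. mass K (insert u s) * (h u)\<^sup>2)"
proof -
  define V where "V = ext K s"
  define w where "w u = mass K (insert u s)" for u
  define W where "W = real (d - j) * mass K s"
  \<comment> \<open>Edge masses extended by zero to all pairs of link vertices, so that
    \<open>m\<close> is a full matrix on \<open>V\<close>.\<close>
  define p where "p u v = (if v \<in> ext K (insert u s) then mass K (insert v (insert u s)) else 0)" for u v
  define m where "m u v = p u v / real (d - Suc j) - w u * w v / W" for u v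
  have fin: "finite V" by (simp add: V_def)
  have us: "insert u s \<in> faces K (Suc j)" if "u \<in> V" for u
    using that s by (simp add: ext_iff V_def)
  have w_pos: "w u > 0" if "u \<in> V" for u
    using us[OF that] by (simp add: mass_pos w_def)
  have dj: "real (d - Suc j) > 0" using j by simp
  have W: "W > 0" using j mass_pos[OF s] by (simp add: W_def)
  have sum_w: "(\<Sum>u\<in>V. w u) = W" by (simp add: V_def w_def W_def sum_mass_ext[OF s])
  have sub: "ext K (insert u s) \<subseteq> V" if "u \<in> V" for u
    using that finite_face[OF s] card_face[OF s]
    by (auto simp: ext_insert_iff[OF s that[unfolded V_def]] V_def ext_iff[OF s] face_iff)
  have psum: "(\<Sum>v\<in>V. p u v * g v) = (\<Sum>v\<in>ext K (insert u s). mass K (insert v (insert u s)) * g v)"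
    if "u \<in> V" for u g
  proof -
    have "(\<Sum>v\<in>V. p u v * g v) = (\<Sum>v\<in>ext K (insert u s). p u v * g v)"
      using sub[OF that] fin by (intro sum.mono_neutral_right) (auto simp: p_def)
    then show ?thesis by (simp add: p_def)
  qed
  have sym: "m u v = m v u" if "u \<in> V" "v \<in> V" for u v
  proof -
    have "v \<in> ext K (insert u s) \<longleftrightarrow> u \<in> ext K (insert v s)"
      using that s by (auto simp: ext_insert_iff[OF s] V_def ext_iff[OF s])
    then show ?thesis by (simp add: m_def p_def insert_commute mult.commute)
  qed
  have mrow: "(\<Sum>v\<in>V. m u v * g v)
      = (\<Sum>v\<in>ext K (insert u s). mass K (insert v (insert u s)) * g v) / real (d - Suc j)
        - w u * (\<Sum>v\<in>V. w v * g v) / W" if "u \<in> V" for u g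
    unfolding psum[OF that, of g, symmetric]
    by (simp add: m_def algebra_simps sum_subtractf sum_divide_distrib sum_distrib_left)
  \<comment> \<open>By \<open>sum_mass_ext\<close> at \<open>insert u s\<close> the adjacency part
    of row \<open>u\<close> sums to \<open>w u\<close>; so does the rank-one part, because the
    weights have total \<open>W\<close>.\<close>
  have mzero: "(\<Sum>v\<in>V. m u v) = 0" if "u \<in> V" for u
    using mrow[OF that, of "\<lambda>_. 1"] sum_mass_ext[OF us[OF that]] dj W
    by (simp add: sum_w) (simp add: w_def)
  have "\<bar>\<Sum>u\<in>V. \<Sum>v\<in>V. m u v * h u * h v\<bar> \<le> \<gamma> * (\<Sum>u\<in>V. w u * (h u)\<^sup>2)"
  proof (rule symmetric_form_bound[OF fin w_pos sym])
    fix \<mu> g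
    assume nz: "\<exists>u\<in>V. g u \<noteq> 0" and eig: "\<And>u. u \<in> V \<Longrightarrow> (\<Sum>v\<in>V. m u v * g v) = \<mu> * (w u * g u)"
    show "\<bar>\<mu>\<bar> \<le> \<gamma>"
    \<comment> \<open>The constants are eigenvectors of \<open>m\<close> with eigenvalue 0, so this
      value need not come from a nontrivial eigenvalue; it is bounded because \<gamma> is
      nonnegative.\<close>
    proof (cases "\<mu> = 0")
      case False
      have "\<mu> * (\<Sum>u\<in>V. w u * g u) = (\<Sum>u\<in>V. \<Sum>v\<in>V. m u v * g v)"
        by (simp add: eig sum_distrib_left)
      also have "\<dots> = (\<Sum>v\<in>V. (\<Sum>u\<in>V. m u v) * g v)"
        by (subst sum.swap) (simp add: sum_distrib_right)
      also have "\<dots> = (\<Sum>v\<in>V. (\<Sum>u\<in>V. m v u) * g v)"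
      proof -
        have "(\<Sum>u\<in>V. m u v) = (\<Sum>u\<in>V. m v u)" if "v \<in> V" for v
          using sym that by (intro sum.cong) auto
        then show ?thesis by simp
      qed
      also have "\<dots> = 0" by (simp add: mzero)
      finally have orth: "(\<Sum>u\<in>V. w u * g u) = 0" using False by simp
      have "\<exists>u\<in>V. \<exists>v\<in>V. g u \<noteq> g v"
      proof (rule ccontr)
        assume const: "\<not> ?thesis"
        obtain u where u: "u \<in> V" "g u \<noteq> 0" using nz by blast
        then have "g v = g u" if "v \<in> V" for v using const that by blast
        then have "(\<Sum>v\<in>V. w v * g v) = W * g u"
          unfolding sum_w[symmetric] sum_distrib_right by simp
        then show False using orth u W by simp
      qed
      \<comment> \<open>Orthogonality to the constants removes the rank-one part, so an eigenvector
        of \<open>m\<close> is one of the walk for the same eigenvalue.\<close>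
      moreover have "skeleton_walk (face_link K s) g u = \<mu> * g u" if "u \<in> V" for u
      proof -
        define S where "S = (\<Sum>v\<in>ext K (insert u s). mass K (insert v (insert u s)) * g v)"
        have "S / real (d - Suc j) = \<mu> * (w u * g u)"
          using eig[OF that] mrow[OF that, of g] orth by (simp add: S_def)
        moreover have "skeleton_walk (face_link K s) g u = S / real (d - Suc j) / w u"
          using link_walk[OF s j that[unfolded V_def], of g] by (simp add: S_def w_def)
        ultimately show ?thesis using w_pos[OF that] by simp
      qed
      ultimately have "nontrivial_walk_eigenvalue (face_link K s) \<mu>"
        unfolding nontrivial_walk_eigenvalue_def link_skeleton(1)[OF s] V_def by blast
      then show ?thesis
        using expander s j unfolding two_sided_local_spectral_expander_def by blast
    qed (simp add: \<gamma>_nonneg)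
  qed
  moreover have "(\<Sum>u\<in>V. \<Sum>v\<in>V. m u v * h u * h v)
      = (\<Sum>u\<in>V. h u * ((\<Sum>v\<in>ext K (insert u s). mass K (insert v (insert u s)) * h v) / real (d - Suc j)
        - w u * (\<Sum>v\<in>V. w v * h v) / W))"
  proof (intro sum.cong refl)
    fix u assume "u \<in> V"
    show "(\<Sum>v\<in>V. m u v * h u * h v)
        = h u * ((\<Sum>v\<in>ext K (insert u s). mass K (insert v (insert u s)) * h v) / real (d - Suc j)
          - w u * (\<Sum>v\<in>V. w v * h v) / W)"
      unfolding mrow[OF \<open>u \<in> V\<close>, symmetric] by (simp add: sum_distrib_left mult_ac)
  qed
  moreover have "\<dots> = (\<Sum>u\<in>V. \<Sum>v\<in>ext K (insert u s). mass K (insert v (insert u s)) * (h u * h v)) / real (d - Suc j)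
      - (\<Sum>u\<in>V. w u * h u)\<^sup>2 / W"
    by (simp add: right_diff_distrib sum_subtractf sum_divide_distrib sum_distrib_left
        sum_distrib_right power2_eq_square mult_ac)
  ultimately show ?thesis by (simp add: V_def w_def W_def)
qed

text \<open>Squaring \<open>Up K i h y\<close> gives a sum over ordered pairs of vertices deleted
  from \<open>y\<close>. Equal vertices contribute exactly
  \<open>face_ip K i h h / real (Suc i)\<close>. Distinct ones, grouped by the face \<open>s\<close>
  left after deleting both, give the adjacency forms of the links, while the norm of
  \<open>Down K i h\<close> collects the rank-one parts. \<open>link_form_bound\<close> compares the
  two for each \<open>s\<close>.\<close>

lemma Up_quadratic_defect:
  assumes i: "i < d"
  shows "\<bar>face_ip K (Suc i) (Up K i h) (Up K i h) - face_ip K i h h / real (Suc i)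
      - real i / real (Suc i) * face_ip K (i - 1) (Down K i h) (Down K i h)\<bar>
    \<le> \<gamma> * (real i / real (Suc i) * face_ip K i h h)"
proof -
  define R where "R = real (Suc i) * real (d choose i)"
  define D where "D = (\<Sum>x\<in>faces K i. mass K x * (h x)\<^sup>2)"
  \<comment> \<open>The contribution of distinct deleted vertices: with
    \<open>y = insert v x\<close>, the face \<open>insert v (x - {u})\<close> is \<open>y\<close>
    without \<open>u\<close>.\<close>
  define A where "A = (\<Sum>x\<in>faces K i. \<Sum>v\<in>ext K x. \<Sum>u\<in>x.
      mass K (insert v x) * (h x * h (insert v (x - {u}))))"
  have R: "R > 0" using i by (simp add: R_def)
  have bin: "real (Suc i) * real (d choose Suc i) = real (d - i) * real (d choose i)"
    using binomial_step[OF i] by simp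
  have ip: "face_ip K i h h = D / real (d choose i)"
    using i by (simp add: face_ip_eq D_def power2_eq_square)
  have sq: "(\<Sum>v\<in>y. h (y - {v}))\<^sup>2
      = (\<Sum>v\<in>y. (h (y - {v}))\<^sup>2 + (\<Sum>u\<in>y - {v}. h (y - {v}) * h (insert v (y - {v} - {u}))))"
    if y: "y \<in> faces K (Suc i)" for y
  proof -
    have "(\<Sum>v\<in>y. h (y - {v}))\<^sup>2 = (\<Sum>v\<in>y. \<Sum>u\<in>y. h (y - {v}) * h (y - {u}))"
      by (simp add: power2_eq_square sum_product)
    also have "\<dots> = (\<Sum>v\<in>y. (h (y - {v}))\<^sup>2 + (\<Sum>u\<in>y - {v}. h (y - {v}) * h (y - {u})))"
      using finite_face[OF y] by (intro sum.cong refl) (simp add: sum.remove power2_eq_square)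
    also have "\<dots> = (\<Sum>v\<in>y. (h (y - {v}))\<^sup>2 + (\<Sum>u\<in>y - {v}. h (y - {v}) * h (insert v (y - {v} - {u}))))"
    proof (intro sum.cong refl arg_cong2[where f="(+)"])
      fix v u assume "v \<in> y" "u \<in> y - {v}"
      then have "insert v (y - {v} - {u}) = y - {u}" by auto
      then show "h (y - {v}) * h (y - {u}) = h (y - {v}) * h (insert v (y - {v} - {u}))" by simp
    qed
    finally show ?thesis .
  qed
  have "(\<Sum>y\<in>faces K (Suc i). mass K y * (Up K i h y * Up K i h y))
      = (\<Sum>y\<in>faces K (Suc i). \<Sum>v\<in>y. mass K (insert v (y - {v})) * (h (y - {v}))\<^sup>2
          + (\<Sum>u\<in>y - {v}. mass K (insert v (y - {v})) * (h (y - {v}) * h (insert v (y - {v} - {u})))))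
        / (real (Suc i))\<^sup>2"
    unfolding sum_divide_distrib[of _ "faces K (Suc i)"]
  proof (rule sum.cong[OF refl])
    fix y assume y: "y \<in> faces K (Suc i)"
    have "mass K y * (Up K i h y * Up K i h y) = mass K y * (\<Sum>v\<in>y. h (y - {v}))\<^sup>2 / (real (Suc i))\<^sup>2"
      by (simp add: Up_eq[OF y] power2_eq_square)
    then show "mass K y * (Up K i h y * Up K i h y)
        = (\<Sum>v\<in>y. mass K (insert v (y - {v})) * (h (y - {v}))\<^sup>2
          + (\<Sum>u\<in>y - {v}. mass K (insert v (y - {v})) * (h (y - {v}) * h (insert v (y - {v} - {u})))))
        / (real (Suc i))\<^sup>2"
      unfolding sq[OF y] by (simp add: sum_distrib_left distrib_left insert_absorb)
  qed
  also have "\<dots> = (\<Sum>x\<in>faces K i. \<Sum>v\<in>ext K x. mass K (insert v x) * (h x)\<^sup>2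
          + (\<Sum>u\<in>x. mass K (insert v x) * (h x * h (insert v (x - {u}))))) / (real (Suc i))\<^sup>2"
    by (simp only: flag_reindex[of "\<lambda>x v. mass K (insert v x) * (h x)\<^sup>2
          + (\<Sum>u\<in>x. mass K (insert v x) * (h x * h (insert v (x - {u}))))" i])
  also have "\<dots> = (real (d - i) * D + A) / (real (Suc i))\<^sup>2"
    by (simp add: sum.distrib A_def D_def sum_mass_ext sum_distrib_left mult.assoc flip: sum_distrib_right)
  finally have "face_ip K (Suc i) (Up K i h) (Up K i h)
      = (real (d - i) * D + A) / (real (Suc i) * (real (Suc i) * real (d choose Suc i)))"
    using i by (simp add: face_ip_eq power2_eq_square mult.assoc)
  also have "\<dots> = D / R + A / real (d - i) / R"
  proof -
    have "(c * D + A) / (r * (c * b)) = D / (r * b) + A / c / (r * b)" if "c > 0" "r > 0" "b > 0" for c r b :: real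
      using that by (simp add: field_simps)
    from this[of "real (d - i)" "real (Suc i)" "real (d choose i)"] show ?thesis
      unfolding bin R_def using i by simp
  qed
  finally have up: "face_ip K (Suc i) (Up K i h) (Up K i h) - face_ip K i h h / real (Suc i)
      = A / real (d - i) / R"
    by (simp add: ip R_def mult.commute)
  show ?thesis
  proof (cases i)
    \<comment> \<open>The only 0-face is empty, so there are no pairs of distinct vertices, and the
      coefficient \<open>real i\<close> removes the meaningless \<open>Down K 0\<close>.\<close>
    case 0
    then have "A = 0" by (simp add: A_def faces_0)
    then show ?thesis using up 0 by simp
  next
    case (Suc j)
    \<comment> \<open>For the link of \<open>s\<close>, \<open>a s\<close> is the adjacency form and
      \<open>b s\<close> its trivial part, the squared weighted sum of \<open>h\<close> over the
      link vertices.\<close>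
    define a where "a s = (\<Sum>u\<in>ext K s. \<Sum>v\<in>ext K (insert u s).
        mass K (insert v (insert u s)) * (h (insert u s) * h (insert v s))) / real (d - Suc j)" for s
    define b where "b s = (\<Sum>u\<in>ext K s. mass K (insert u s) * h (insert u s))\<^sup>2 / (real (d - j) * mass K s)" for s
    have j: "j < d" "j + 2 \<le> d" using i Suc by auto
    have A: "A / real (d - i) = (\<Sum>s\<in>faces K j. a s)"
    proof -
      have "A = (\<Sum>x\<in>faces K (Suc j). \<Sum>u\<in>x. (\<lambda>s u. \<Sum>v\<in>ext K (insert u s).
          mass K (insert v (insert u s)) * (h (insert u s) * h (insert v s))) (x - {u}) u)"
      proof -
        have "(\<Sum>v\<in>ext K x. \<Sum>u\<in>x. mass K (insert v x) * (h x * h (insert v (x - {u}))))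
            = (\<Sum>u\<in>x. \<Sum>v\<in>ext K (insert u (x - {u})). mass K (insert v (insert u (x - {u})))
                * (h (insert u (x - {u})) * h (insert v (x - {u}))))" for x
          by (subst sum.swap) (intro sum.cong refl, simp_all add: insert_absorb)
        then show ?thesis unfolding A_def Suc by simp
      qed
      also have "\<dots> = (\<Sum>s\<in>faces K j. \<Sum>u\<in>ext K s. \<Sum>v\<in>ext K (insert u s).
          mass K (insert v (insert u s)) * (h (insert u s) * h (insert v s)))"
        by (simp only: flag_reindex[of "\<lambda>s u. \<Sum>v\<in>ext K (insert u s).
          mass K (insert v (insert u s)) * (h (insert u s) * h (insert v s))" j])
      finally show ?thesis by (simp add: a_def Suc sum_divide_distrib)
    qed
    have Dn: "real i / real (Suc i) * face_ip K (i - 1) (Down K i h) (Down K i h)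
        = (\<Sum>s\<in>faces K j. b s) / R"
    proof -
      have "mass K s * (Down K (Suc j) h s * Down K (Suc j) h s) = b s / real (d - j)"
        if s: "s \<in> faces K j" for s
        using mass_pos[OF s] j by (simp add: Down_eq[OF s] b_def power2_eq_square)
      then have "face_ip K j (Down K (Suc j) h) (Down K (Suc j) h)
          = (\<Sum>s\<in>faces K j. b s) / (real (d - j) * real (d choose j))"
        using j by (simp add: face_ip_eq sum_divide_distrib)
      then show ?thesis
        unfolding binomial_step[OF j(1)] by (simp add: Suc R_def)
    qed
    have "\<bar>(\<Sum>s\<in>faces K j. a s) - (\<Sum>s\<in>faces K j. b s)\<bar> \<le> (\<Sum>s\<in>faces K j. \<bar>a s - b s\<bar>)"
      by (simp add: sum_subtractf[symmetric])
    also have "\<dots> \<le> (\<Sum>s\<in>faces K j. \<gamma> * (\<Sum>u\<in>ext K s. mass K (insert u s) * (h (insert u s))\<^sup>2))"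
      unfolding a_def b_def by (intro sum_mono link_form_bound j)
    \<comment> \<open>Each face of size \<open>i\<close> is reached from its \<open>i\<close>
      subfaces, which produces the factor \<open>i\<close> in the bound.\<close>
    also have "\<dots> = \<gamma> * (real i * D)"
    proof -
      have "(\<Sum>s\<in>faces K j. \<Sum>u\<in>ext K s. mass K (insert u s) * (h (insert u s))\<^sup>2)
          = (\<Sum>x\<in>faces K (Suc j). \<Sum>u\<in>x. mass K x * (h x)\<^sup>2)"
        unfolding flag_reindex[symmetric] by (intro sum.cong refl) (simp add: insert_absorb)
      also have "\<dots> = real i * D"
        unfolding D_def Suc sum_distrib_left by (intro sum.cong refl) (simp add: card_face)
      finally show ?thesis by (simp flip: sum_distrib_left)
    qed
    finally have "\<bar>(\<Sum>s\<in>faces K j. a s) / R - (\<Sum>s\<in>faces K j. b s) / R\<bar> \<le> \<gamma> * (real i * D) / R"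
      using R by (simp add: abs_divide divide_right_mono flip: diff_divide_distrib)
    then show ?thesis
      unfolding up A Dn by (simp add: ip R_def)
  qed
qed

end

section \<open>Almost commutation of the up and down operators\<close>

definition face_norm :: "wcomplex \<Rightarrow> nat \<Rightarrow> (nat set \<Rightarrow> real) \<Rightarrow> real" where
  "face_norm K i f = sqrt (face_ip K i f f)"

lemma face_ip_linear:
  "face_ip K i (\<lambda>x. f x + f' x) g = face_ip K i f g + face_ip K i f' g"
  "face_ip K i (\<lambda>x. f x - f' x) g = face_ip K i f g - face_ip K i f' g"
  "face_ip K i (\<lambda>x. c * f x) g = c * face_ip K i f g"
  "face_ip K i (\<lambda>x. f x / c) g = face_ip K i f g / c"
  "face_ip K i (\<lambda>x. \<Sum>j\<in>J. F j x) g = (\<Sum>j\<in>J. face_ip K i (F j) g)"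
  "face_ip K i g (\<lambda>x. f x + f' x) = face_ip K i g f + face_ip K i g f'"
  "face_ip K i g (\<lambda>x. f x - f' x) = face_ip K i g f - face_ip K i g f'"
  "face_ip K i g (\<lambda>x. c * f x) = c * face_ip K i g f"
  "face_ip K i g (\<lambda>x. \<Sum>j\<in>J. F j x) = (\<Sum>j\<in>J. face_ip K i g (F j))"
  by (simp_all add: face_ip_def face_expect_def algebra_simps sum.distrib sum_subtractf
      sum_distrib_left sum_divide_distrib sum.swap[of _ J])

lemma Up_linear:
  "Up K i (\<lambda>x. f x + g x) = (\<lambda>y. Up K i f y + Up K i g y)"
  "Up K i (\<lambda>x. c * f x) = (\<lambda>y. c * Up K i f y)"
  "Up K i (\<lambda>x. 0) = (\<lambda>x. 0)"
  by (simp_all add: Up_def fun_eq_iff sum.distrib add_divide_distrib sum_distrib_left sum_divide_distrib)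

lemma Down_linear:
  "Down K i (\<lambda>x. f x + g x) = (\<lambda>y. Down K i f y + Down K i g y)"
  "Down K i (\<lambda>x. c * f x) = (\<lambda>y. c * Down K i f y)"
  "Down K i (\<lambda>x. 0) = (\<lambda>x. 0)"
  by (simp_all add: Down_def fun_eq_iff algebra_simps sum.distrib add_divide_distrib sum_distrib_left)

lemma Up_iter_self: "Up_iter K l l f = f"
  by (simp add: Up_iter_def)

lemma Up_iter_Suc: "l \<le> k \<Longrightarrow> Up_iter K l (Suc k) f = Up K k (Up_iter K l k f)"
  by (simp add: Up_iter_def)

lemma Up_iter_trans:
  assumes "j \<le> l" "l \<le> k"
  shows "Up_iter K l k (Up_iter K j l f) = Up_iter K j k f"
  using assms(2,1) by (induction k rule: dec_induct) (simp_all add: Up_iter_self Up_iter_Suc)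

lemma Down_iter_self: "Down_iter K l l f = f"
  by (simp add: Down_iter_def)

lemma Down_iter_Suc: "l \<le> k \<Longrightarrow> Down_iter K (Suc k) l f = Down_iter K k l (Down K (Suc k) f)"
  by (simp add: Down_iter_def)

lemma Down_iter_linear:
  assumes "l \<le> k"
  shows "Down_iter K k l (\<lambda>x. f x + g x) = (\<lambda>y. Down_iter K k l f y + Down_iter K k l g y)"
    and "Down_iter K k l (\<lambda>x. c * f x) = (\<lambda>y. c * Down_iter K k l f y)"
    and "Down_iter K k l (\<lambda>x. 0) = (\<lambda>y. 0)"
  using assms
  by (induction k arbitrary: f g rule: dec_induct)
    (simp_all add: Down_iter_self Down_iter_Suc Down_linear)

section \<open>Norms, contraction and adjointness of the iterated operators\<close>

context weighted_cx
begin

lemma face_ip_nonneg: "i \<le> d \<Longrightarrow> 0 \<le> face_ip K i f f"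
  unfolding face_ip_def face_expect_def
  by (intro sum_nonneg mult_nonneg_nonneg[OF _ zero_le_square] less_imp_le[OF face_prob_pos])

lemma face_norm_nonneg: "i \<le> d \<Longrightarrow> 0 \<le> face_norm K i f"
  by (simp add: face_norm_def face_ip_nonneg)

lemma face_norm_square: "i \<le> d \<Longrightarrow> (face_norm K i f)\<^sup>2 = face_ip K i f f"
  by (simp add: face_norm_def face_ip_nonneg)

lemma face_ip_cong:
  "\<lbrakk>\<And>x. x \<in> faces K i \<Longrightarrow> f x = f' x; \<And>x. x \<in> faces K i \<Longrightarrow> g x = g' x\<rbrakk>
    \<Longrightarrow> face_ip K i f g = face_ip K i f' g'"
  by (simp add: face_ip_def face_expect_def)

text \<open>Scaling values by the square root of the probability turns the norm into a Euclidean
  one, from which the Cauchy-Schwarz and triangle inequalities are inherited.\<close>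

lemma face_norm_L2:
  assumes "i \<le> d"
  shows "face_norm K i f = L2_set (\<lambda>x. sqrt (face_prob K i x) * f x) (faces K i)"
  unfolding face_norm_def L2_set_def face_ip_def face_expect_def
  by (intro arg_cong[where f=sqrt] sum.cong refl)
    (simp add: power_mult_distrib less_imp_le[OF face_prob_pos[OF assms]] flip: power2_eq_square)

lemma face_ip_Cauchy_Schwarz:
  assumes "i \<le> d"
  shows "\<bar>face_ip K i f g\<bar> \<le> face_norm K i f * face_norm K i g"
proof -
  have "\<bar>face_ip K i f g\<bar> \<le> (\<Sum>x\<in>faces K i. \<bar>face_prob K i x * (f x * g x)\<bar>)"
    unfolding face_ip_def face_expect_def by (rule sum_abs)
  also have "\<dots> = (\<Sum>x\<in>faces K i. \<bar>sqrt (face_prob K i x) * f x\<bar> * \<bar>sqrt (face_prob K i x) * g x\<bar>)"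
  proof (intro sum.cong refl)
    fix x assume "x \<in> faces K i"
    then have "sqrt (face_prob K i x) * sqrt (face_prob K i x) = face_prob K i x"
      using face_prob_pos[OF assms] by (simp add: less_imp_le)
    then have "face_prob K i x * (f x * g x) = (sqrt (face_prob K i x) * f x) * (sqrt (face_prob K i x) * g x)"
      by (metis mult.assoc mult.left_commute)
    then show "\<bar>face_prob K i x * (f x * g x)\<bar>
        = \<bar>sqrt (face_prob K i x) * f x\<bar> * \<bar>sqrt (face_prob K i x) * g x\<bar>"
      by (simp add: abs_mult)
  qed
  also have "\<dots> \<le> face_norm K i f * face_norm K i g"
    unfolding face_norm_L2[OF assms] by (rule L2_set_mult_ineq)
  finally show ?thesis .
qed

lemma face_norm_triangle:
  "i \<le> d \<Longrightarrow> face_norm K i (\<lambda>x. f x + g x) \<le> face_norm K i f + face_norm K i g"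
  using L2_set_triangle_ineq[of "\<lambda>x. sqrt (face_prob K i x) * f x" "\<lambda>x. sqrt (face_prob K i x) * g x"]
  by (simp add: face_norm_L2 distrib_left)

lemma face_norm_scale: "face_norm K i (\<lambda>x. c * f x) = \<bar>c\<bar> * face_norm K i f"
  by (simp add: face_norm_def face_ip_linear real_sqrt_mult flip: mult.assoc)

lemma Down_one:
  assumes "x \<in> faces K i" "i < d"
  shows "Down K (Suc i) (\<lambda>_. 1) x = 1"
  using assms mass_pos[OF assms(1)] by (simp add: Down_eq sum_mass_ext)

lemma Up_one: "y \<in> faces K (Suc i) \<Longrightarrow> Up K i (\<lambda>_. 1) y = 1"
  by (simp add: Up_eq card_face)

text \<open>Pointwise, the square of an average is at most the average of the squares. Adjointness
  then moves \<open>Up\<close> onto the constant 1, which \<open>Down\<close> fixes.\<close>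

lemma face_norm_Up:
  assumes i: "i < d"
  shows "face_norm K (Suc i) (Up K i h) \<le> face_norm K i h"
proof -
  have "face_ip K (Suc i) (Up K i h) (Up K i h) \<le> face_ip K (Suc i) (Up K i (\<lambda>x. (h x)\<^sup>2)) (\<lambda>_. 1)"
    unfolding face_ip_def face_expect_def
  proof (intro sum_mono mult_left_mono)
    fix y assume y: "y \<in> faces K (Suc i)"
    have "(\<Sum>v\<in>y. h (y - {v}))\<^sup>2 \<le> real (card y) * (\<Sum>v\<in>y. (h (y - {v}))\<^sup>2)"
      using sum_squared_le_sum_of_squares[of "\<lambda>v. h (y - {v})" y] by (simp add: mult.commute)
    then show "Up K i h y * Up K i h y \<le> Up K i (\<lambda>x. (h x)\<^sup>2) y * 1"
      by (simp add: Up_eq[OF y] card_face[OF y] power2_eq_square divide_simps mult.commute del: of_nat_Suc)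
    show "0 \<le> face_prob K (Suc i) y" using face_prob_pos[OF _ y] i by simp
  qed
  also have "\<dots> = face_ip K i (\<lambda>x. (h x)\<^sup>2) (Down K (Suc i) (\<lambda>_. 1))"
    by (rule Up_Down_adjoint[OF i])
  also have "\<dots> = face_ip K i h h"
    using i by (simp add: face_ip_def face_expect_def Down_one power2_eq_square)
  finally show ?thesis by (simp add: face_norm_def)
qed

text \<open>The adjoint of a contraction is a contraction: write the squared norm as the inner
  product of \<open>Up K i (Down K (Suc i) h)\<close> with \<open>h\<close>, apply Cauchy-Schwarz
  and cancel.\<close>

lemma face_norm_Down:
  assumes i: "i < d"
  shows "face_norm K i (Down K (Suc i) h) \<le> face_norm K (Suc i) h"
proof -
  have "(face_norm K i (Down K (Suc i) h))\<^sup>2 = face_ip K (Suc i) (Up K i (Down K (Suc i) h)) h"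
    using i by (simp add: face_norm_square Up_Down_adjoint)
  also have "\<dots> \<le> face_norm K (Suc i) (Up K i (Down K (Suc i) h)) * face_norm K (Suc i) h"
    using face_ip_Cauchy_Schwarz[of "Suc i"] i by (meson Suc_leI abs_le_D1)
  also have "\<dots> \<le> face_norm K i (Down K (Suc i) h) * face_norm K (Suc i) h"
    using i by (intro mult_right_mono face_norm_Up face_norm_nonneg) auto
  finally have "face_norm K i (Down K (Suc i) h) * face_norm K i (Down K (Suc i) h)
      \<le> face_norm K i (Down K (Suc i) h) * face_norm K (Suc i) h"
    by (simp add: power2_eq_square)
  moreover have "0 \<le> face_norm K i (Down K (Suc i) h)" "0 \<le> face_norm K (Suc i) h"
    using i by (simp_all add: face_norm_nonneg)
  ultimately show ?thesis by (metis mult_le_cancel_left_pos order_le_less)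
qed

lemma face_norm_Up_iter:
  assumes "j \<le> k" "k \<le> d"
  shows "face_norm K k (Up_iter K j k h) \<le> face_norm K j h"
  using assms
proof (induction k rule: dec_induct)
  case (step k)
  then show ?case using face_norm_Up[of k "Up_iter K j k h"] by (simp add: Up_iter_Suc)
qed (simp add: Up_iter_self)

lemma face_norm_Down_iter:
  assumes "l \<le> k" "k \<le> d"
  shows "face_norm K l (Down_iter K k l h) \<le> face_norm K k h"
  using assms
proof (induction k arbitrary: h rule: dec_induct)
  case (step k)
  then have "face_norm K l (Down_iter K k l (Down K (Suc k) h)) \<le> face_norm K k (Down K (Suc k) h)"
    by simp
  also have "\<dots> \<le> face_norm K (Suc k) h" using step by (simp add: face_norm_Down)
  finally show ?case using step by (simp add: Down_iter_Suc)
qed (simp add: Down_iter_self)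

lemma Up_Down_iter_adjoint:
  assumes "l \<le> k" "k \<le> d"
  shows "face_ip K k (Up_iter K l k h) g = face_ip K l h (Down_iter K k l g)"
  using assms
proof (induction k arbitrary: g rule: dec_induct)
  case (step k)
  then show ?case by (simp add: Up_iter_Suc Down_iter_Suc Up_Down_adjoint)
qed (simp add: Up_iter_self Down_iter_self)

lemma HD_kernel_Down:
  assumes "h \<in> HD_kernel K j" "0 < j"
  shows "Down K j h = (\<lambda>_. 0)"
  using assms by (simp add: HD_kernel_def)

lemma HD_kernel_Down_iter:
  assumes h: "h \<in> HD_kernel K j" and l: "l < j"
  shows "Down_iter K j l h = (\<lambda>_. 0)"
proof (cases j)
  case (Suc i)
  then show ?thesis
    using HD_kernel_Down[OF h] l by (simp add: Down_iter_Suc Down_iter_linear(3))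
qed (use l in simp)

text \<open>At \<open>i = 0\<close> the last term has coefficient zero, so the truncated index
  \<open>i - 1\<close> and the meaningless \<open>Down K 0\<close> do no harm.\<close>

definition DU_defect :: "nat \<Rightarrow> (nat set \<Rightarrow> real) \<Rightarrow> nat set \<Rightarrow> real" where
  "DU_defect i h x = Down K (Suc i) (Up K i h) x - h x / real (Suc i)
    - real i / real (Suc i) * Up K (i - 1) (Down K i h) x"

text \<open>The right-hand side is symmetric in \<open>h\<close> and \<open>g\<close>, so the defect
  is self-adjoint; on the diagonal it is the quantity bounded by
  \<open>Up_quadratic_defect\<close>.\<close>

lemma DU_defect_form:
  assumes i: "i < d"
  shows "face_ip K i (DU_defect i h) g = face_ip K (Suc i) (Up K i h) (Up K i g)
      - face_ip K i h g / real (Suc i)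
      - real i / real (Suc i) * face_ip K (i - 1) (Down K i h) (Down K i g)"
proof -
  have "face_ip K i (Down K (Suc i) (Up K i h)) g = face_ip K (Suc i) (Up K i h) (Up K i g)"
    using Up_Down_adjoint[OF i, of g "Up K i h"] by (simp add: face_ip_commute)
  moreover have "real i * face_ip K i (Up K (i - 1) (Down K i h)) g
      = real i * face_ip K (i - 1) (Down K i h) (Down K i g)"
    using i Up_Down_adjoint[of "i - 1" "Down K i h" g] by (cases i) auto
  ultimately show ?thesis
    unfolding DU_defect_def[abs_def] face_ip_linear by (simp add: divide_simps)
qed

end

section \<open>Norm of the commutation defect, its iteration, and almost orthogonality\<close>

context expander
begin

text \<open>
  Polarisation of the quadratic bound along the line spanned by \<open>h\<close> and its own defect gives the
  operator norm.
\<close>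

lemma DU_defect_norm:
  assumes i: "i < d"
  shows "face_norm K i (DU_defect i h) \<le> \<gamma> * (real i / real (Suc i)) * face_norm K i h"
proof -
  define c where "c = \<gamma> * (real i / real (Suc i))"
  define e where "e = DU_defect i h"
  have c: "c \<ge> 0" using \<gamma>_nonneg by (simp add: c_def)
  have q: "\<bar>face_ip K i (DU_defect i f) f\<bar> \<le> c * face_ip K i f f" for f
    using Up_quadratic_defect[OF i, of f] by (simp add: DU_defect_form[OF i] c_def mult.assoc)
  have self_adjoint: "face_ip K i (DU_defect i f) g = face_ip K i (DU_defect i g) f" for f g
    unfolding DU_defect_form[OF i]
    using face_ip_commute[of "Suc i" "Up K i f" "Up K i g"] face_ip_commute[of i f g]
      face_ip_commute[of "i - 1" "Down K i f" "Down K i g"] by simp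
  have expand: "face_ip K i (DU_defect i (\<lambda>x. h x + t * e x)) (\<lambda>x. h x + t * e x)
      = face_ip K i (DU_defect i h) h + 2 * t * face_ip K i e e + t\<^sup>2 * face_ip K i (DU_defect i e) e" for t
  proof -
    have "DU_defect i (\<lambda>x. h x + t * e x) = (\<lambda>x. DU_defect i h x + t * DU_defect i e x)"
      by (simp add: fun_eq_iff DU_defect_def Up_linear Down_linear add_divide_distrib algebra_simps)
    then show ?thesis
      using self_adjoint[of e h]
      by (simp add: face_ip_linear power2_eq_square algebra_simps) (simp add: e_def)
  qed
  have expand': "face_ip K i (\<lambda>x. h x + t * e x) (\<lambda>x. h x + t * e x)
      = face_ip K i h h + 2 * t * face_ip K i h e + t\<^sup>2 * face_ip K i e e" for t
    by (simp add: face_ip_linear face_ip_commute[of i e h] power2_eq_square algebra_simps)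
  \<comment> \<open>Subtracting the form at \<open>-t\<close> from the form at \<open>t\<close>
    isolates the mixed term, while the mixed terms on the right cancel when the two bounds are
    added.\<close>
  have key: "2 * t * face_ip K i e e \<le> c * (face_ip K i h h + t\<^sup>2 * face_ip K i e e)" for t
  proof -
    have "4 * t * face_ip K i e e
        \<le> c * (face_ip K i h h + 2 * t * face_ip K i h e + t\<^sup>2 * face_ip K i e e)
          + c * (face_ip K i h h + 2 * (- t) * face_ip K i h e + (- t)\<^sup>2 * face_ip K i e e)"
      using q[of "\<lambda>x. h x + t * e x"] q[of "\<lambda>x. h x + (- t) * e x"]
      unfolding expand expand' by (simp add: abs_le_iff)
    then show ?thesis by (simp add: algebra_simps)
  qed
  \<comment> \<open>The choice \<open>t = 1 / c\<close> gives the sharp bound; \<open>c = 0\<close>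
    is separated, since there \<open>key\<close> at any positive \<open>t\<close> already forces a
    zero norm.\<close>
  have "face_ip K i e e \<le> c\<^sup>2 * face_ip K i h h"
  proof (cases "c = 0")
    case True
    then show ?thesis using key[of 1] by simp
  next
    case False
    then show ?thesis
      using key[of "1 / c"] c by (simp add: power2_eq_square field_simps)
  qed
  then have "(face_norm K i e)\<^sup>2 \<le> (c * face_norm K i h)\<^sup>2"
    using i by (simp add: face_norm_square power_mult_distrib)
  then have "face_norm K i e \<le> c * face_norm K i h"
    by (rule power2_le_imp_le) (use i c in \<open>simp add: face_norm_nonneg\<close>)
  then show ?thesis by (simp add: e_def c_def)
qed

text \<open>Induction on \<open>i\<close>. At \<open>i = j\<close> the term with \<open>Up\<close>
  after \<open>Down\<close> vanishes, as \<open>h\<close> is in the kernel. In the step the defect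
  relation leaves \<open>Up\<close> applied to the previous instance, and \<open>coef\<close> is the
  recursion of the coefficients. The new defect adds \<gamma> to the inherited error
  \<open>i\<close> times \<gamma>, and the common factor \<open>(i + 1) / (i + 2)\<close> is
  dropped.\<close>

lemma Down_Up_iter_approx:
  assumes h: "h \<in> HD_kernel K j" and "j \<le> i" "i < d"
  shows "face_norm K i (\<lambda>x. Down K (Suc i) (Up_iter K j (Suc i) h) x
      - real (Suc i - j) / real (Suc i) * Up_iter K j i h x) \<le> real i * \<gamma> * face_norm K j h"
  using assms(2,3)
proof (induction i rule: dec_induct)
  case base
  have "Up K (j - 1) (Down K j h) x = 0" if "j > 0" for x
    using HD_kernel_Down[OF h that] by (simp add: Up_linear)
  then have "(\<lambda>x. Down K (Suc j) (Up_iter K j (Suc j) h) x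
      - real (Suc j - j) / real (Suc j) * Up_iter K j j h x) = DU_defect j h"
    by (cases "j = 0") (simp_all add: fun_eq_iff DU_defect_def Up_iter_Suc Up_iter_self)
  moreover have "\<gamma> * (real j / real (Suc j)) * face_norm K j h \<le> real j * \<gamma> * face_norm K j h"
    using base \<gamma>_nonneg by (intro mult_right_mono face_norm_nonneg) (auto simp: field_simps)
  ultimately show ?case using DU_defect_norm[OF base, of h] by simp
next
  case (step i)
  define F where "F = Up_iter K j i h"
  define F' where "F' = Up_iter K j (Suc i) h"
  define r where "r x = Down K (Suc i) F' x - real (Suc i - j) / real (Suc i) * F x" for x
  have F': "F' = Up K i F" using step by (simp add: F'_def F_def Up_iter_Suc)
  have i: "i < d" "Suc i < d" using step by auto
  have r: "face_norm K i r \<le> real i * \<gamma> * face_norm K j h"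
    using step.IH i unfolding r_def F_def F'_def by simp
  have "Down K (Suc i) F' = (\<lambda>x. real (Suc i - j) / real (Suc i) * F x + r x)"
    by (simp add: r_def fun_eq_iff)
  then have "Up K i (Down K (Suc i) F') x = real (Suc i - j) / real (Suc i) * F' x + Up K i r x" for x
    unfolding F' by (simp only: Up_linear)
  then have *: "Down K (Suc (Suc i)) (Up K (Suc i) F') x
      = DU_defect (Suc i) F' x + F' x / real (Suc (Suc i))
        + real (Suc i) / real (Suc (Suc i)) * (real (Suc i - j) / real (Suc i) * F' x + Up K i r x)" for x
    by (simp add: DU_defect_def del: of_nat_Suc)
  have coef: "1 / real (Suc (Suc i)) + real (Suc i) / real (Suc (Suc i)) * (real (Suc i - j) / real (Suc i))
      = real (Suc (Suc i) - j) / real (Suc (Suc i))"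
    using step by (simp add: Suc_diff_le divide_simps)
  have "Down K (Suc (Suc i)) (Up K (Suc i) F') x - real (Suc (Suc i) - j) / real (Suc (Suc i)) * F' x
      = DU_defect (Suc i) F' x + real (Suc i) / real (Suc (Suc i)) * Up K i r x" for x
    unfolding * coef[symmetric] by (simp add: algebra_simps del: of_nat_Suc)
  then have "face_norm K (Suc i) (\<lambda>x. Down K (Suc (Suc i)) (Up_iter K j (Suc (Suc i)) h) x
      - real (Suc (Suc i) - j) / real (Suc (Suc i)) * Up_iter K j (Suc i) h x)
      = face_norm K (Suc i) (\<lambda>x. DU_defect (Suc i) F' x + real (Suc i) / real (Suc (Suc i)) * Up K i r x)"
    using step by (simp add: Up_iter_Suc[of j "Suc i"] flip: F'_def)
  also have "\<dots> \<le> face_norm K (Suc i) (DU_defect (Suc i) F')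
      + real (Suc i) / real (Suc (Suc i)) * face_norm K (Suc i) (Up K i r)"
    using face_norm_triangle[of "Suc i" "DU_defect (Suc i) F'" "\<lambda>x. real (Suc i) / real (Suc (Suc i)) * Up K i r x"] i
    by (simp add: face_norm_scale del: of_nat_Suc times_divide_eq_left times_divide_eq_right)
  also have "\<dots> \<le> \<gamma> * (real (Suc i) / real (Suc (Suc i))) * face_norm K j h
      + real (Suc i) / real (Suc (Suc i)) * (real i * \<gamma> * face_norm K j h)"
  proof (intro add_mono mult_left_mono)
    have "face_norm K (Suc i) (DU_defect (Suc i) F')
        \<le> \<gamma> * (real (Suc i) / real (Suc (Suc i))) * face_norm K (Suc i) F'"
      using i by (intro DU_defect_norm)
    also have "\<dots> \<le> \<gamma> * (real (Suc i) / real (Suc (Suc i))) * face_norm K j h"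
      using step \<gamma>_nonneg i unfolding F'_def by (intro mult_left_mono face_norm_Up_iter) auto
    finally show "face_norm K (Suc i) (DU_defect (Suc i) F')
        \<le> \<gamma> * (real (Suc i) / real (Suc (Suc i))) * face_norm K j h" .
    show "face_norm K (Suc i) (Up K i r) \<le> real i * \<gamma> * face_norm K j h"
      using face_norm_Up[OF i(1), of r] r by simp
  qed simp
  also have "\<dots> = (real (Suc i) / real (Suc (Suc i))) * (real (Suc i) * \<gamma> * face_norm K j h)"
    by (simp add: algebra_simps add_divide_distrib)
  also have "\<dots> \<le> 1 * (real (Suc i) * \<gamma> * face_norm K j h)"
    using \<gamma>_nonneg step by (intro mult_right_mono mult_nonneg_nonneg face_norm_nonneg) auto
  finally show ?case by simp
qed

text \<open>Removing one \<open>Down\<close> and one \<open>Up\<close> from level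
  \<open>Suc k\<close> costs the factor \<open>q\<close>, and these factors telescope to the
  quotient of binomials. Starting the induction at \<open>max j l\<close> treats
  \<open>j \<le> l\<close> and \<open>l < j\<close> together. Since \<open>Down_iter\<close> is a
  contraction, each step adds an error of at most \<open>k\<close> times \<gamma>.\<close>

lemma Down_iter_Up_iter_approx:
  assumes h: "h \<in> HD_kernel K j" and "j \<le> k" "l \<le> k" "k \<le> d"
  shows "face_norm K l (\<lambda>x. Down_iter K k l (Up_iter K j k h) x
      - real (l choose j) / real (k choose j) * Up_iter K j l h x) \<le> (real k)\<^sup>2 * \<gamma> * face_norm K j h"
proof -
  have "max j l \<le> k" using assms by simp
  then show ?thesis using assms(4)
  proof (induction k rule: dec_induct)
    \<comment> \<open>For \<open>l < j\<close> the binomial is zero, and \<open>Down_iter\<close>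
      vanishes because the first operator it applies, \<open>Down K j\<close>, kills
      \<open>h\<close>. Otherwise no \<open>Down\<close> is applied and the quotient is one.\<close>
    case base
    have "(\<lambda>x. Down_iter K (max j l) l (Up_iter K j (max j l) h) x
        - real (l choose j) / real (max j l choose j) * Up_iter K j l h x) = (\<lambda>x. 0)"
    proof (cases "l < j")
      case True
      then show ?thesis
        using HD_kernel_Down_iter[OF h True] by (simp add: Up_iter_self max_def binomial_eq_0)
    next
      case False
      then show ?thesis by (simp add: max_def Down_iter_self fun_eq_iff)
    qed
    moreover have "face_norm K l (\<lambda>x. 0) = 0" by (simp add: face_norm_def face_ip_def face_expect_def)
    ultimately show ?case
      using base \<gamma>_nonneg by (simp add: face_norm_nonneg)
  next
    case (step k)
    have k: "j \<le> k" "l \<le> k" "k < d" using step by auto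
    define q where "q = real (Suc k - j) / real (Suc k)"
    define r where "r x = Down K (Suc k) (Up_iter K j (Suc k) h) x - q * Up_iter K j k h x" for x
    define E where "E x = Down_iter K k l (Up_iter K j k h) x
      - real (l choose j) / real (k choose j) * Up_iter K j l h x" for x
    have coef: "q / real (k choose j) = 1 / real (Suc k choose j)"
    proof -
      have "real (Suc k choose j) * real (Suc k - j) = real (Suc k) * real (k choose j)"
        using binomial_absorb_comp[of "Suc k" j] by (metis diff_Suc_1 mult.commute of_nat_mult)
      then show ?thesis using k by (simp add: q_def field_simps del: of_nat_Suc of_nat_diff)
    qed
    have "Down K (Suc k) (Up_iter K j (Suc k) h) = (\<lambda>x. q * Up_iter K j k h x + r x)"
      by (simp add: r_def fun_eq_iff)
    then have "Down_iter K (Suc k) l (Up_iter K j (Suc k) h)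
        = (\<lambda>x. q * Down_iter K k l (Up_iter K j k h) x + Down_iter K k l r x)"
      using k by (simp add: Down_iter_Suc Down_iter_linear)
    moreover have "real (l choose j) / real (Suc k choose j)
        = q * (real (l choose j) / real (k choose j))"
      using arg_cong[OF coef, of "\<lambda>z. real (l choose j) * z"] by (simp add: mult.commute)
    ultimately have "(\<lambda>x. Down_iter K (Suc k) l (Up_iter K j (Suc k) h) x
        - real (l choose j) / real (Suc k choose j) * Up_iter K j l h x)
        = (\<lambda>x. q * E x + Down_iter K k l r x)"
      by (simp add: E_def fun_eq_iff algebra_simps)
    then have "face_norm K l (\<lambda>x. Down_iter K (Suc k) l (Up_iter K j (Suc k) h) x
        - real (l choose j) / real (Suc k choose j) * Up_iter K j l h x)
        = face_norm K l (\<lambda>x. q * E x + Down_iter K k l r x)"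
      by simp
    also have "\<dots> \<le> \<bar>q\<bar> * face_norm K l E + face_norm K l (Down_iter K k l r)"
      using face_norm_triangle[of l "\<lambda>x. q * E x" "Down_iter K k l r"] k by (simp add: face_norm_scale)
    also have "\<dots> \<le> 1 * ((real k)\<^sup>2 * \<gamma> * face_norm K j h) + real k * \<gamma> * face_norm K j h"
    proof (intro add_mono mult_mono)
      show "\<bar>q\<bar> \<le> 1" by (simp add: q_def)
      show "face_norm K l E \<le> (real k)\<^sup>2 * \<gamma> * face_norm K j h"
        using step.IH k unfolding E_def by simp
      show "0 \<le> face_norm K l E" using k by (simp add: face_norm_nonneg)
      have "face_norm K l (Down_iter K k l r) \<le> face_norm K k r"
        using k by (simp add: face_norm_Down_iter)
      also have "\<dots> \<le> real k * \<gamma> * face_norm K j h"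
        using Down_Up_iter_approx[OF h k(1) k(3)] unfolding r_def q_def .
      finally show "face_norm K l (Down_iter K k l r) \<le> real k * \<gamma> * face_norm K j h" .
    qed simp
    also have "\<dots> \<le> (real (Suc k))\<^sup>2 * \<gamma> * face_norm K j h"
    proof -
      have "((real k)\<^sup>2 + real k) * (\<gamma> * face_norm K j h) \<le> (real (Suc k))\<^sup>2 * (\<gamma> * face_norm K j h)"
        using \<gamma>_nonneg k by (intro mult_right_mono mult_nonneg_nonneg face_norm_nonneg)
          (auto simp: power2_eq_square algebra_simps)
      then show ?thesis by (simp add: algebra_simps)
    qed
    finally show ?case .
  qed
qed

text \<open>Almost orthogonality of the levels gives the lower bound on \<open>\<parallel>f\<parallel>\<close>.\<close>

lemma level_norms_bound:
  assumes g: "\<And>j. j \<le> k \<Longrightarrow> g j \<in> HD_kernel K j" and k: "k \<le> d"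
    and f: "f = (\<lambda>x. \<Sum>j\<le>k. Up_iter K j k (g j) x)"
    and small: "2 ^ Suc k * ((real k)\<^sup>2 * real (Suc k) * \<gamma>) \<le> 1"
  shows "(\<Sum>j\<le>k. (face_norm K j (g j))\<^sup>2) \<le> 2 ^ Suc k * (face_norm K k f)\<^sup>2"
proof -
  define F where "F j = Up_iter K j k (g j)" for j
  define a where "a j = face_norm K j (g j)" for j
  define \<epsilon> where "\<epsilon> = (real k)\<^sup>2 * \<gamma>"
  define A where "A = (\<Sum>j\<le>k. (a j)\<^sup>2)"
  have \<epsilon>: "\<epsilon> \<ge> 0" using \<gamma>_nonneg by (simp add: \<epsilon>_def)
  have a: "a j \<ge> 0" if "j \<le> k" for j using that k by (simp add: a_def face_norm_nonneg)
  \<comment> \<open>With \<open>i \<le> j\<close>, adjointness moves the \<open>Up\<close> operators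
    of \<open>F i\<close> to the other side as \<open>Down\<close>. The main term of the result has
    coefficient \<open>i choose j\<close>, which survives for \<open>i = j\<close> only.\<close>
  have approx: "\<bar>face_ip K k (F i) (F j) - (if i = j then (a j)\<^sup>2 / real (k choose j) else 0)\<bar> \<le> a i * (\<epsilon> * a j)"
    if ij: "i \<le> j" "j \<le> k" for i j
  proof -
    define r where "r x = Down_iter K k i (F j) x - real (i choose j) / real (k choose j) * Up_iter K j i (g j) x" for x
    have "face_ip K k (F i) (F j) = face_ip K i (g i) (Down_iter K k i (F j))"
      unfolding F_def using ij k by (intro Up_Down_iter_adjoint) auto
    also have "Down_iter K k i (F j) = (\<lambda>x. r x + real (i choose j) / real (k choose j) * Up_iter K j i (g j) x)"
      by (simp add: r_def fun_eq_iff)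
    also have "face_ip K i (g i) \<dots> = face_ip K i (g i) r
        + real (i choose j) / real (k choose j) * face_ip K i (g i) (Up_iter K j i (g j))"
      by (simp only: face_ip_linear)
    also have "real (i choose j) / real (k choose j) * face_ip K i (g i) (Up_iter K j i (g j))
        = (if i = j then (a j)\<^sup>2 / real (k choose j) else 0)"
      using ij k by (auto simp: Up_iter_self a_def face_norm_square binomial_eq_0)
    finally have "\<bar>face_ip K k (F i) (F j) - (if i = j then (a j)\<^sup>2 / real (k choose j) else 0)\<bar>
        = \<bar>face_ip K i (g i) r\<bar>" by simp
    also have "\<dots> \<le> a i * face_norm K i r"
      unfolding a_def using ij k by (intro face_ip_Cauchy_Schwarz) auto
    also have "\<dots> \<le> a i * (\<epsilon> * a j)"
      using Down_iter_Up_iter_approx[OF g, of j k i] ij k a[of i]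
      unfolding r_def F_def a_def \<epsilon>_def by (intro mult_left_mono) auto
    finally show ?thesis .
  qed
  \<comment> \<open>Symmetry removes the order of \<open>i\<close> and \<open>j\<close>, and the
    binomial is replaced by its uniform bound \<open>2 ^ k\<close>.\<close>
  have lower: "(if i = j then (a j)\<^sup>2 / 2 ^ k else 0) - \<epsilon> * (a i * a j) \<le> face_ip K k (F i) (F j)"
    if ij: "i \<le> k" "j \<le> k" for i j
  proof -
    have "(a j)\<^sup>2 / 2 ^ k \<le> (a j)\<^sup>2 / real (k choose j)"
    proof (rule divide_left_mono)
      have "k choose j \<le> 2 ^ k" by (rule binomial_le_pow2)
      then show "real (k choose j) \<le> 2 ^ k" by (metis of_nat_le_iff of_nat_numeral of_nat_power)
    qed (use ij in auto)
    moreover have "i \<le> j \<or> j \<le> i" by linarith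
    ultimately show ?thesis
      using approx[of i j] approx[of j i] ij face_ip_commute[of k "F i" "F j"]
      by (auto simp: abs_le_iff mult_ac split: if_splits)
  qed
  have "(\<Sum>j\<le>k. a j)\<^sup>2 \<le> real (Suc k) * A"
    using sum_squared_le_sum_of_squares[of a "{..k}"] by (simp add: A_def mult.commute)
  then have "A / 2 ^ k - \<epsilon> * (real (Suc k) * A) \<le> A / 2 ^ k - \<epsilon> * (\<Sum>j\<le>k. a j)\<^sup>2"
    using \<epsilon> by (simp add: mult_left_mono)
  also have "\<dots> = (\<Sum>i\<le>k. \<Sum>j\<le>k. (if i = j then (a j)\<^sup>2 / 2 ^ k else 0) - \<epsilon> * (a i * a j))"
  proof -
    have "\<epsilon> * (\<Sum>j\<le>k. a j)\<^sup>2 = (\<Sum>i\<le>k. \<Sum>j\<le>k. \<epsilon> * (a i * a j))"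
      unfolding power2_eq_square sum_product by (simp only: sum_distrib_left)
    then show ?thesis by (simp add: sum_subtractf A_def sum_divide_distrib)
  qed
  also have "\<dots> \<le> (\<Sum>i\<le>k. \<Sum>j\<le>k. face_ip K k (F i) (F j))"
    by (intro sum_mono lower) auto
  also have "\<dots> = (face_norm K k f)\<^sup>2"
  proof -
    have "face_ip K k f f = (\<Sum>i\<le>k. face_ip K k (F i) f)"
      by (subst (1) f) (simp only: face_ip_linear F_def)
    also have "\<dots> = (\<Sum>i\<le>k. \<Sum>j\<le>k. face_ip K k (F i) (F j))"
      unfolding f by (simp only: face_ip_linear F_def)
    finally show ?thesis using k by (simp add: face_norm_square)
  qed
  finally have *: "A / 2 ^ k - \<epsilon> * (real (Suc k) * A) \<le> (face_norm K k f)\<^sup>2" .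
  have "A \<ge> 0" unfolding A_def by (simp add: sum_nonneg)
  \<comment> \<open>The hypothesis \<open>small\<close> makes the cross terms cost at most half of
    the main term \<open>A / 2 ^ k\<close>, so the other half stays below the squared norm of
    \<open>f\<close>.\<close>
  then have "2 ^ Suc k * (\<epsilon> * (real (Suc k) * A)) \<le> A"
    using mult_right_mono[OF small, of A] by (simp add: \<epsilon>_def mult_ac)
  moreover have "2 ^ Suc k * (A / 2 ^ k - \<epsilon> * (real (Suc k) * A)) \<le> 2 ^ Suc k * (face_norm K k f)\<^sup>2"
    using * by (intro mult_left_mono) auto
  ultimately have "A \<le> 2 ^ Suc k * (face_norm K k f)\<^sup>2"
    by (simp add: right_diff_distrib del: of_nat_Suc)
  then show ?thesis by (simp add: A_def a_def)
qed

section \<open>Expectation, variance and the level formula\<close>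

lemma face_expect_ip: "face_expect K i f = face_ip K i (\<lambda>_. 1) f"
  by (simp add: face_ip_def)

lemma face_expect_Up: "i < d \<Longrightarrow> face_expect K (Suc i) (Up K i h) = face_expect K i h"
  unfolding face_expect_ip
  using Up_Down_adjoint[of i h "\<lambda>_. 1"] face_ip_cong[of i h h "Down K (Suc i) (\<lambda>_. 1)" "\<lambda>_. 1"] Down_one
  by (simp add: face_ip_commute)

lemma face_expect_Down: "i < d \<Longrightarrow> face_expect K i (Down K (Suc i) h) = face_expect K (Suc i) h"
  unfolding face_expect_ip
  using Up_Down_adjoint[of i "\<lambda>_. 1" h] face_ip_cong[of "Suc i" "Up K i (\<lambda>_. 1)" "\<lambda>_. 1" h h] Up_one
  by simp

lemma face_expect_Up_iter:
  assumes "j \<le> k" "k \<le> d"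
  shows "face_expect K k (Up_iter K j k h) = face_expect K j h"
  using assms by (induction k rule: dec_induct) (simp_all add: Up_iter_self Up_iter_Suc face_expect_Up)

lemma face_expect_Down_iter:
  assumes "l \<le> k" "k \<le> d"
  shows "face_expect K l (Down_iter K k l h) = face_expect K k h"
  using assms
  by (induction k arbitrary: h rule: dec_induct) (simp_all add: Down_iter_self Down_iter_Suc face_expect_Down)

lemma face_prob_0: "face_prob K 0 {} = 1"
  using face_prob_eq[of 0 "{}"] by (simp add: faces_0 mass_empty)

lemma face_expect_0: "face_expect K 0 h = h {}"
  by (simp add: face_expect_def faces_0 face_prob_0)

lemma face_expect_1:
  assumes "i \<le> d"
  shows "face_expect K i (\<lambda>_. 1) = 1"
  using assms
proof (induction i)
  case (Suc i)
  then have "face_expect K (Suc i) (\<lambda>_. 1) = face_expect K (Suc i) (Up K i (\<lambda>_. 1))"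
    unfolding face_expect_ip by (intro face_ip_cong) (simp_all add: Up_one)
  then show ?case using Suc by (simp add: face_expect_Up)
qed (simp add: face_expect_0)

lemma face_var_eq:
  assumes "i \<le> d"
  shows "face_var K i g = face_ip K i g g - (face_expect K i g)\<^sup>2"
proof -
  define e where "e = face_expect K i g"
  have "face_var K i g = (\<Sum>x\<in>faces K i. face_prob K i x * (g x * g x)
      - 2 * e * (face_prob K i x * g x) + e\<^sup>2 * (face_prob K i x * 1))"
    unfolding face_var_def e_def[symmetric] unfolding face_expect_def[of K i "\<lambda>x. (g x - e)\<^sup>2"]
    by (intro sum.cong refl) (simp add: power2_eq_square algebra_simps)
  also have "\<dots> = face_ip K i g g - 2 * e * face_expect K i g + e\<^sup>2 * face_expect K i (\<lambda>_. 1)"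
    by (simp only: sum.distrib sum_subtractf face_ip_def face_expect_def flip: sum_distrib_left)
  finally show ?thesis
    by (simp add: face_expect_1[OF assms] power2_eq_square flip: e_def)
qed

text \<open>\<open>Down\<close> preserves the expectation and sends \<open>h\<close> to
  zero.\<close>

lemma face_expect_HD_kernel:
  assumes "h \<in> HD_kernel K j" "0 < j" "j \<le> d"
  shows "face_expect K j h = 0"
proof -
  obtain i where i: "j = Suc i" using assms(2) by (cases j) auto
  then have "face_expect K j h = face_expect K i (Down K j h)"
    using assms by (simp add: face_expect_Down)
  then show ?thesis using HD_kernel_Down[OF assms(1,2)] by (simp add: face_expect_def)
qed

text \<open>Only one of the two factors in the squared norm of \<open>Df\<close> is expanded into
  levels. Replacing \<open>Down_iter K k l (fs j)\<close> by a multiple of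
  \<open>Up_iter K j l (g j)\<close> and moving back by adjointness gives exactly
  \<open>face_ip K k f (fs j)\<close>, so each level has error at most
  \<open>N * (\<epsilon> * a j)\<close>.\<close>

lemma variance_level_bound:
  assumes f: "HD_level_set_decomposition K k f fs" and k: "k \<le> d" and l: "l \<le> k"
    and small: "2 ^ Suc k * ((real k)\<^sup>2 * real (Suc k) * \<gamma>) \<le> 1"
  shows "\<bar>face_var K l (Down_iter K k l f)
      - (\<Sum>j=1..l. real (l choose j) / real (k choose j) * face_ip K k f (fs j))\<bar>
    \<le> (real k)\<^sup>2 * real (Suc k) * 2 ^ Suc k * \<gamma> * face_ip K k f f"
proof -
  have "\<forall>j\<in>{..k}. \<exists>h. h \<in> HD_kernel K j \<and> fs j = Up_iter K j k h"
    using f by (auto simp: HD_level_set_decomposition_def HD_space_def)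
  then obtain g where g: "\<And>j. j \<le> k \<Longrightarrow> g j \<in> HD_kernel K j" "\<And>j. j \<le> k \<Longrightarrow> fs j = Up_iter K j k (g j)"
    by (metis atMost_iff)
  have f_sum: "f = (\<lambda>x. \<Sum>j\<le>k. fs j x)" using f by (simp add: HD_level_set_decomposition_def)
  define Df where "Df = Down_iter K k l f"
  define N where "N = face_norm K k f"
  define a where "a j = face_norm K j (g j)" for j
  define \<epsilon> where "\<epsilon> = (real k)\<^sup>2 * \<gamma>"
  define c where "c j = real (l choose j) / real (k choose j)" for j
  have ld: "l \<le> d" using k l by simp
  have N: "N \<ge> 0" using k by (simp add: N_def face_norm_nonneg)
  have \<epsilon>: "\<epsilon> \<ge> 0" using \<gamma>_nonneg by (simp add: \<epsilon>_def)
  have level: "\<bar>face_ip K l Df (Down_iter K k l (fs j)) - c j * face_ip K k f (fs j)\<bar> \<le> N * (\<epsilon> * a j)"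
    if j: "j \<le> k" for j
  proof -
    define r where "r x = Down_iter K k l (fs j) x - c j * Up_iter K j l (g j) x" for x
    have "Down_iter K k l (fs j) = (\<lambda>x. r x + c j * Up_iter K j l (g j) x)"
      by (simp add: r_def fun_eq_iff)
    then have "face_ip K l Df (Down_iter K k l (fs j)) = face_ip K l Df r + c j * face_ip K l Df (Up_iter K j l (g j))"
      by (simp only: face_ip_linear)
    moreover have "c j * face_ip K l Df (Up_iter K j l (g j)) = c j * face_ip K k f (fs j)"
    proof (cases "j \<le> l")
      case True
      have "face_ip K k (Up_iter K l k (Up_iter K j l (g j))) f = face_ip K l (Up_iter K j l (g j)) Df"
        unfolding Df_def using l k by (rule Up_Down_iter_adjoint)
      then show ?thesis
        using Up_iter_trans[OF True l] g(2)[OF j] by (simp add: face_ip_commute)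
    qed (simp add: c_def binomial_eq_0)
    ultimately have "\<bar>face_ip K l Df (Down_iter K k l (fs j)) - c j * face_ip K k f (fs j)\<bar> = \<bar>face_ip K l Df r\<bar>"
      by simp
    also have "\<dots> \<le> face_norm K l Df * face_norm K l r"
      using ld by (rule face_ip_Cauchy_Schwarz)
    also have "\<dots> \<le> N * (\<epsilon> * a j)"
    proof (rule mult_mono)
      show "face_norm K l Df \<le> N" unfolding Df_def N_def using l k by (rule face_norm_Down_iter)
      show "face_norm K l r \<le> \<epsilon> * a j"
        using Down_iter_Up_iter_approx[OF g(1)[OF j] j l k]
        unfolding r_def[abs_def] g(2)[OF j] \<epsilon>_def a_def c_def .
    qed (use N ld in \<open>auto simp: face_norm_nonneg\<close>)
    finally show ?thesis .
  qed
  have "face_ip K l Df Df = face_ip K k f (Up_iter K l k Df)"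
    using Up_Down_iter_adjoint[OF l k, of Df f] by (simp add: Df_def face_ip_commute)
  also have "\<dots> = (\<Sum>j\<le>k. face_ip K k (fs j) (Up_iter K l k Df))"
    by (subst f_sum) (simp only: face_ip_linear)
  also have "\<dots> = (\<Sum>j\<le>k. face_ip K l Df (Down_iter K k l (fs j)))"
    using Up_Down_iter_adjoint[OF l k, of Df] by (simp add: face_ip_commute)
  finally have norm_Df: "face_ip K l Df Df = (\<Sum>j\<le>k. face_ip K l Df (Down_iter K k l (fs j)))" .
  \<comment> \<open>Higher levels have mean zero, so the constant level carries the whole mean of
    \<open>f\<close>, which \<open>Down_iter\<close> preserves. Its term, with coefficient
    \<open>c 0 = 1\<close>, cancels the square subtracted in the variance.\<close>
  have mean: "face_ip K k f (fs 0) = (face_expect K l Df)\<^sup>2"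
  proof -
    have "face_ip K k f (fs 0) = face_ip K 0 (g 0) (Down_iter K k 0 f)"
      using Up_Down_iter_adjoint[of 0 k "g 0" f] k g(2)[of 0] by (simp add: face_ip_commute)
    also have "\<dots> = face_expect K 0 (g 0) * face_expect K k f"
      using k face_expect_Down_iter[of 0 k f] by (simp add: face_expect_0 face_ip_def)
    also have "face_expect K 0 (g 0) = face_expect K k f"
    proof -
      have "face_expect K k f = (\<Sum>j\<le>k. face_expect K k (fs j))"
        unfolding face_expect_ip by (subst f_sum) (simp only: face_ip_linear)
      also have "\<dots> = (\<Sum>j\<le>k. if j = 0 then face_expect K 0 (g 0) else 0)"
        using g k by (intro sum.cong refl) (simp add: face_expect_Up_iter face_expect_HD_kernel)
      finally show ?thesis by simp
    qed
    finally show ?thesis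
      using l k by (simp add: Df_def face_expect_Down_iter power2_eq_square)
  qed
  \<comment> \<open>Levels above \<open>l\<close> drop out, since \<open>l choose j\<close> is zero
    there.\<close>
  have "(\<Sum>j\<le>k. c j * face_ip K k f (fs j)) = (\<Sum>j\<le>l. c j * face_ip K k f (fs j))"
    using l by (intro sum.mono_neutral_right) (auto simp: c_def binomial_eq_0)
  also have "\<dots> = face_ip K k f (fs 0) + (\<Sum>j=1..l. c j * face_ip K k f (fs j))"
    by (simp add: atMost_atLeast0 sum.atLeast_Suc_atMost c_def)
  finally have "face_var K l Df - (\<Sum>j=1..l. c j * face_ip K k f (fs j))
      = (\<Sum>j\<le>k. face_ip K l Df (Down_iter K k l (fs j)) - c j * face_ip K k f (fs j))"
    using ld by (simp add: face_var_eq norm_Df mean sum_subtractf)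
  also have "\<bar>\<dots>\<bar> \<le> (\<Sum>j\<le>k. N * (\<epsilon> * a j))"
    by (intro order_trans[OF sum_abs] sum_mono level) auto
  also have "\<dots> = N * \<epsilon> * (\<Sum>j\<le>k. a j)"
    by (simp add: sum_distrib_left mult_ac)
  also have "\<dots> \<le> N * \<epsilon> * (real (Suc k) * 2 ^ Suc k * N)"
  proof (rule mult_left_mono)
    have "(\<Sum>j\<le>k. (a j)\<^sup>2) \<le> 2 ^ Suc k * N\<^sup>2"
      unfolding a_def N_def using g f_sum k small by (intro level_norms_bound) auto
    have "(\<Sum>j\<le>k. a j)\<^sup>2 \<le> real (Suc k) * (\<Sum>j\<le>k. (a j)\<^sup>2)"
      using sum_squared_le_sum_of_squares[of a "{..k}"] by (simp add: mult.commute)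
    also have "\<dots> \<le> real (Suc k) * (2 ^ Suc k * N\<^sup>2)"
      by (rule mult_left_mono[OF \<open>(\<Sum>j\<le>k. (a j)\<^sup>2) \<le> 2 ^ Suc k * N\<^sup>2\<close>]) simp
    \<comment> \<open>The constant is at least one, so squaring it only weakens the bound and spares
      a square root in the final estimate.\<close>
    also have "\<dots> \<le> (real (Suc k) * 2 ^ Suc k)\<^sup>2 * N\<^sup>2"
    proof -
      have "(1::real) \<le> 2 ^ Suc k" by (rule one_le_power) simp
      then have "1 \<le> real (Suc k) * 2 ^ Suc k"
        using mult_mono[of 1 "real (Suc k)" 1 "2 ^ Suc k :: real"] by (simp del: power_Suc)
      then have "real (Suc k) * 2 ^ Suc k \<le> (real (Suc k) * 2 ^ Suc k)\<^sup>2"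
        by (rule self_le_power) simp
      then have "real (Suc k) * 2 ^ Suc k * N\<^sup>2 \<le> (real (Suc k) * 2 ^ Suc k)\<^sup>2 * N\<^sup>2"
        by (rule mult_right_mono) simp
      then show ?thesis by (simp only: mult.assoc)
    qed
    finally have "(\<Sum>j\<le>k. a j)\<^sup>2 \<le> (real (Suc k) * 2 ^ Suc k * N)\<^sup>2"
      by (simp only: power_mult_distrib)
    then show "(\<Sum>j\<le>k. a j) \<le> real (Suc k) * 2 ^ Suc k * N"
      by (rule power2_le_imp_le) (simp add: N)
  qed (use N \<epsilon> in auto)
  also have "\<dots> = (real k)\<^sup>2 * real (Suc k) * 2 ^ Suc k * \<gamma> * face_ip K k f f"
    unfolding face_norm_square[OF k, symmetric] N_def \<epsilon>_def by (simp only: power2_eq_square mult_ac)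
  finally show ?thesis by (simp add: Df_def c_def)
qed

end

section \<open>The absolute constants\<close>

lemma level_constant_bound: "(real k)\<^sup>2 * real (Suc k) * 2 ^ Suc k \<le> 2 powr (5 * real k)"
proof (cases "k = 0")
  case False
  have n: "Suc k \<le> 2 ^ k" by (rule Suc_leI[OF less_exp])
  then have le: "real (Suc k) \<le> 2 ^ k" by (metis of_nat_le_iff of_nat_numeral of_nat_power)
  \<comment> \<open>The three factors are bounded by \<open>2 ^ (2 * k)\<close>,
    \<open>2 ^ k\<close> and \<open>2 ^ (2 * k)\<close>; the last bound uses
    \<open>k \<ge> 1\<close>. The exponents add up to \<open>5 * k\<close>.\<close>
  have "(real k)\<^sup>2 * real (Suc k) * 2 ^ Suc k \<le> (2 ^ k)\<^sup>2 * 2 ^ k * 2 ^ (k + k)"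
    using le False by (intro mult_mono power_mono power_increasing) auto
  also have "\<dots> = 2 ^ (5 * k)" by (simp flip: power_add power_mult)
  also have "\<dots> = 2 powr (5 * real k)" by (simp flip: powr_realpow)
  finally show ?thesis .
qed simp

theorem theorem8p2:
  "\<exists>C0 > (0::real). \<exists>C1 > (0::real).
     \<forall>(n::nat) (K::wcomplex) (\<gamma>::real) (k::nat) (f::nat set \<Rightarrow> real) (fs::nat \<Rightarrow> nat set \<Rightarrow> real).
       weighted_complex n K \<longrightarrow> k \<le> cdim K \<longrightarrow>
       0 \<le> \<gamma> \<longrightarrow> two_sided_local_spectral_expander K \<gamma> \<longrightarrow> \<gamma> \<le> 2 powr (- C0 * real k) \<longrightarrow>
       f \<in> cochains K k \<longrightarrow> HD_level_set_decomposition K k f fs \<longrightarrow>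
       (\<forall>l\<le>k. \<exists>c. 0 \<le> c \<and> c \<le> 2 powr (C1 * real k) \<and>
          \<bar>face_var K l (Down_iter K k l f)
            - (\<Sum>j=1..l. real (l choose j) / real (k choose j) * face_ip K k f (fs j))\<bar>
          \<le> c * \<gamma> * face_ip K k f f)"
proof (rule exI[of _ 5], intro conjI, simp, rule exI[of _ 5], intro conjI, simp, intro allI impI)
  fix n k l :: nat and K \<gamma> f fs
  assume K: "weighted_complex n K" and k: "k \<le> cdim K" and \<gamma>: "0 \<le> \<gamma>"
    "two_sided_local_spectral_expander K \<gamma>" "\<gamma> \<le> 2 powr (- 5 * real k)"
    and f: "HD_level_set_decomposition K k f fs" and l: "l \<le> k"
  interpret expander n K \<gamma> using K \<gamma> by unfold_locales
  define c where "c = (real k)\<^sup>2 * real (Suc k) * 2 ^ Suc k"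
  \<comment> \<open>One bound on \<open>c\<close> serves twice: it gives \<open>C1 = 5\<close>, and
    with \<open>C0 = 5\<close> it makes the product of \<open>c\<close> and \<gamma> at most one,
    which is the smallness required for the lower bound on the norm of \<open>f\<close>.\<close>
  have "c * \<gamma> \<le> 2 powr (5 * real k) * 2 powr (- 5 * real k)"
    unfolding c_def using \<gamma> by (intro mult_mono level_constant_bound) auto
  then have "2 ^ Suc k * ((real k)\<^sup>2 * real (Suc k) * \<gamma>) \<le> 1"
    by (simp add: c_def mult_ac flip: powr_add)
  from variance_level_bound[OF f k l this]
  show "\<exists>c. 0 \<le> c \<and> c \<le> 2 powr (5 * real k) \<and>
      \<bar>face_var K l (Down_iter K k l f)
        - (\<Sum>j=1..l. real (l choose j) / real (k choose j) * face_ip K k f (fs j))\<bar>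
      \<le> c * \<gamma> * face_ip K k f f"
    using level_constant_bound[of k] by (intro exI[of _ c]) (simp add: c_def)
qed

end
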